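(* There exists an absolute constant $\tilde C>1$ such that the following holds. Let $1\le m\le n$ be integers, let $\mu$ be a measure on $\mathbb{R}^n$ with a radially decreasing density, let $0\le s<\infty$, and let $H\subset\mathbb{R}^n$ be an $m$-dimensional linear subspace. Let $f\colon\mathbb{R}^n\to[0,\infty)$ be a $\mu$-integrable, $\left(\frac1s\right)$-concave function assuming its maximum at the origin, and suppose $z_0\in\mathbb{R}^n$ satisfies $$\sup_{z\in\mathbb{R}^n}\mu\big((\mathrm{supp}(f)-z)\cap H\big)=\mu\big((\mathrm{supp}(f)-z_0)\cap H\big)$$ and is such that $\mathrm{supp}(f)-z_0$ contains the origin as an interior point. Then $$\int_H\Delta_{\frac1s}f(x)\,d\mu(x)\le\left[\tilde C\cdot\frac{(n+1)(n+s)}{m(m+1)}\right]^{m+s}\sup_{y\in\mathbb{R}^n}\int_Hf(x+y)\,d\mu(x).$$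
   Context: For $s>0$, $f\colon\mathbb{R}^n\to[0,\infty)$ is $\left(\frac1s\right)$-concave if $f((1-\lambda)x+\lambda y)\ge((1-\lambda)f(x)^{1/s}+\lambda f(y)^{1/s})^s$ for all $\lambda\in[0,1]$ and all $x,y$ with $f(x)f(y)>0$. For $s=0$, $\frac1s$ is read as $+\infty$, and $\infty$-concave means $f((1-\lambda)x+\lambda y)\ge\max\{f(x),f(y)\}$ for all such $x,y,\lambda$. $\Delta_{\frac1s}f(x)=\sup_{x=x_1-x_2}M_{1/s}(f(x_1),f(x_2))$, where for $ab>0$, $M_{1/s}(a,b)=(a^{1/s}+b^{1/s})^s$ if $s>0$ and $M_\infty(a,b)=\max\{a,b\}$ if $s=0$; and $M_{1/s}(a,b)=0$ if $ab=0$. A function $\phi$ is radially decreasing if $\phi(tx)\ge\phi(x)$ for all $t\in[0,1]$, $x\in\mathbb{R}^n$. If $\mu$ has (Borel) density $\phi$ and $H$ is a linear subspace, then $\mu(A\cap H)=\int_H\phi(x)\chi_A(x)\,dx$ and $\int_HF\,d\mu=\int_HF(x)\phi(x)\,dx$, with $dx$ Lebesgue measure on $H$. $\mathrm{supp}(f)$ is the support of $f$, i.e. the set $\{f>0\}$. *)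

theory Defs
  imports "HOL-Analysis.Analysis" "HOL-Library.Function_Algebras"
begin

text \<open>
  The dimension is a bound variable of the statement (the constant must not depend on it), so
  \<open>\<real>\<^sup>n\<close> is the carrier of the library's \<^const>\<open>Euclidean_space\<close>: the
  functions \<open>nat \<Rightarrow> real\<close> that vanish at all indices \<open>\<ge> n\<close>. The vector operations are
  pointwise. Functions on \<open>\<real>\<^sup>n\<close> are total functions on \<open>nat \<Rightarrow> real\<close> whose
  values outside the carrier are irrelevant.
\<close>

instantiation "fun" :: (type, real_vector) real_vector
begin

definition scaleR_fun :: "real \<Rightarrow> ('a \<Rightarrow> 'b) \<Rightarrow> 'a \<Rightarrow> 'b" where
  "scaleR_fun c f = (\<lambda>x. c *\<^sub>R f x)"

instance
  by standard (simp_all add: scaleR_fun_def fun_eq_iff scaleR_add_right scaleR_add_left)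

end

abbreviation Rn :: "nat \<Rightarrow> (nat \<Rightarrow> real) set" where
  "Rn n \<equiv> topspace (Euclidean_space n)"


subsection \<open>Lebesgue measure on subspaces\<close>

definition lborel_Rn :: "nat \<Rightarrow> (nat \<Rightarrow> real) measure" where
  "lborel_Rn n = distr (Pi\<^sub>M {..<n} (\<lambda>_. lborel)) (restrict_space borel (Rn n))
                   (\<lambda>x i. if i < n then x i else 0)"

definition inner_Rn :: "nat \<Rightarrow> (nat \<Rightarrow> real) \<Rightarrow> (nat \<Rightarrow> real) \<Rightarrow> real" where
  "inner_Rn n x y = (\<Sum>i<n. x i * y i)"

definition orthonormal_basis ::
    "nat \<Rightarrow> nat \<Rightarrow> (nat \<Rightarrow> nat \<Rightarrow> real) \<Rightarrow> (nat \<Rightarrow> real) set \<Rightarrow> bool" where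
  "orthonormal_basis n m b H \<longleftrightarrow>
     (\<forall>j<m. b j \<in> Rn n) \<and>
     (\<forall>j<m. \<forall>k<m. inner_Rn n (b j) (b k) = (if j = k then 1 else 0)) \<and>
     span (b ` {..<m}) = H"

text \<open>
  Lebesgue measure on a subspace \<open>H\<close> of \<open>\<real>\<^sup>n\<close>: the image of Lebesgue measure on
  \<open>\<real>\<^sup>m\<close>, \<open>m = dim H\<close>, under the linear isometry given by an orthonormal basis of
  \<open>H\<close>. A basis exists by \<open>ex_orthonormal_basis\<close> below, and the measure does not depend
  on the choice, since Lebesgue measure is invariant under orthogonal maps.
\<close>

definition lborel_subspace :: "nat \<Rightarrow> (nat \<Rightarrow> real) set \<Rightarrow> (nat \<Rightarrow> real) measure" where
  "lborel_subspace n H =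
     (let b = SOME b. orthonormal_basis n (dim H) b H
      in distr (lborel_Rn (dim H)) (restrict_space borel H) (\<lambda>c. \<Sum>j<dim H. c j *\<^sub>R b j))"

text \<open>
  \<open>\<integral>\<^sub>H F d\<mu>\<close> and \<open>\<mu>(A \<inter> H)\<close> for the measure \<open>\<mu>\<close> with density \<open>\<phi>\<close>. The
  integrands of interest (concave up to a power, or indicators of convex sets) are Lebesgue but
  not necessarily Borel measurable on \<open>H\<close>. For these \<^const>\<open>nn_integral\<close> over the Borel
  measure agrees with the integral over its completion (lemma \<open>nn_integral_completion\<close>),
  whereas \<^const>\<open>emeasure\<close> would be \<open>0\<close> on a non-Borel set.
\<close>

definition integral_on ::
    "nat \<Rightarrow> ((nat \<Rightarrow> real) \<Rightarrow> real) \<Rightarrow> (nat \<Rightarrow> real) set \<Rightarrow> ((nat \<Rightarrow> real) \<Rightarrow> ennreal) \<Rightarrow> ennreal"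
  where
  "integral_on n \<phi> H F = (\<integral>\<^sup>+x. F x * ennreal (\<phi> x) \<partial>lborel_subspace n H)"

definition measure_on ::
    "nat \<Rightarrow> ((nat \<Rightarrow> real) \<Rightarrow> real) \<Rightarrow> (nat \<Rightarrow> real) set \<Rightarrow> (nat \<Rightarrow> real) set \<Rightarrow> ennreal" where
  "measure_on n \<phi> H A = integral_on n \<phi> H (indicator A)"

definition density_Rn :: "nat \<Rightarrow> ((nat \<Rightarrow> real) \<Rightarrow> real) \<Rightarrow> (nat \<Rightarrow> real) measure" where
  "density_Rn n \<phi> = density (lborel_Rn n) (\<lambda>x. ennreal (\<phi> x))"

definition radially_decreasing :: "nat \<Rightarrow> ((nat \<Rightarrow> real) \<Rightarrow> real) \<Rightarrow> bool" where
  "radially_decreasing n \<phi> \<longleftrightarrow> (\<forall>x\<in>Rn n. \<forall>t\<in>{0..1}. \<phi> x \<le> \<phi> (t *\<^sub>R x))"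


subsection \<open>Concavity, support and difference function\<close>

text \<open>The parameter \<open>s\<close> stands for exponent \<open>1/s\<close>, with \<open>s = 0\<close> read as exponent \<open>\<infinity>\<close>.\<close>

definition inv_concave :: "nat \<Rightarrow> real \<Rightarrow> ((nat \<Rightarrow> real) \<Rightarrow> real) \<Rightarrow> bool" where
  "inv_concave n s f \<longleftrightarrow>
     (\<forall>x\<in>Rn n. \<forall>y\<in>Rn n. \<forall>t\<in>{0..1}. f x * f y > 0 \<longrightarrow>
        f ((1 - t) *\<^sub>R x + t *\<^sub>R y) \<ge>
          (if s = 0 then max (f x) (f y)
           else ((1 - t) * f x powr (1 / s) + t * f y powr (1 / s)) powr s))"

definition M_inv :: "real \<Rightarrow> real \<Rightarrow> real \<Rightarrow> real" where
  "M_inv s a b =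
     (if a * b > 0 then (if s = 0 then max a b else (a powr (1 / s) + b powr (1 / s)) powr s)
      else 0)"

definition difference_fun ::
    "nat \<Rightarrow> real \<Rightarrow> ((nat \<Rightarrow> real) \<Rightarrow> real) \<Rightarrow> (nat \<Rightarrow> real) \<Rightarrow> ennreal" where
  "difference_fun n s f x =
     (SUP (x1, x2) \<in> {(x1, x2). x1 \<in> Rn n \<and> x2 \<in> Rn n \<and> x = x1 - x2}.
        ennreal (M_inv s (f x1) (f x2)))"

definition supp :: "nat \<Rightarrow> ((nat \<Rightarrow> real) \<Rightarrow> real) \<Rightarrow> (nat \<Rightarrow> real) set" where
  "supp n f = {x \<in> Rn n. f x > 0}"

definition translate :: "(nat \<Rightarrow> real) set \<Rightarrow> (nat \<Rightarrow> real) \<Rightarrow> (nat \<Rightarrow> real) set" where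
  "translate A z = (\<lambda>x. x - z) ` A"


subsection \<open>Well-definedness of the measures\<close>

lemma sum_fun_apply: "(\<Sum>i\<in>A. g i) x = (\<Sum>i\<in>A. g i x)"
  for g :: "'a \<Rightarrow> 'b \<Rightarrow> 'c::comm_monoid_add"
  by (induction A rule: infinite_finite_induct) auto

lemma subspace_Rn: "subspace (Rn n)"
  by (auto simp: subspace_def topspace_Euclidean_space scaleR_fun_def)

lemma Rn_eq_span: "Rn n = span ((\<lambda>i j. if j = i then 1 else 0) ` {..<n})" (is "_ = span ?E")
proof
  show "span ?E \<subseteq> Rn n"
    by (rule span_minimal[OF _ subspace_Rn]) (auto simp: topspace_Euclidean_space)
  show "Rn n \<subseteq> span ?E"
  proof
    fix x assume x: "x \<in> Rn n"
    have "x = (\<Sum>i<n. x i *\<^sub>R (\<lambda>j. if j = i then 1 else 0))"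
    proof
      fix k
      have "(\<Sum>i<n. x i *\<^sub>R (\<lambda>j. if j = i then 1 else 0)) k = (\<Sum>i<n. if k = i then x i else 0)"
        by (simp add: sum_fun_apply scaleR_fun_def if_distrib cong: if_cong)
      also have "\<dots> = x k"
        using x by (simp add: topspace_Euclidean_space)
      finally show "x k = (\<Sum>i<n. x i *\<^sub>R (\<lambda>j. if j = i then 1 else 0)) k" ..
    qed
    also have "\<dots> \<in> span ?E"
      by (intro span_sum span_scale span_base) auto
    finally show "x \<in> span ?E" .
  qed
qed

lemma inner_Rn_commute: "inner_Rn n x y = inner_Rn n y x"
  by (simp add: inner_Rn_def mult.commute)

lemma inner_Rn_add: "inner_Rn n (x + y) z = inner_Rn n x z + inner_Rn n y z"
  by (simp add: inner_Rn_def algebra_simps sum.distrib)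

lemma inner_Rn_scale: "inner_Rn n (c *\<^sub>R x) z = c * inner_Rn n x z"
  by (simp add: inner_Rn_def scaleR_fun_def sum_distrib_left mult.assoc)

lemma inner_Rn_diff: "inner_Rn n (x - y) z = inner_Rn n x z - inner_Rn n y z"
  by (simp add: inner_Rn_def algebra_simps sum_subtractf)

lemma inner_Rn_0: "inner_Rn n 0 z = 0"
  by (simp add: inner_Rn_def)

lemma inner_Rn_sum: "inner_Rn n (\<Sum>i\<in>A. g i) z = (\<Sum>i\<in>A. inner_Rn n (g i) z)"
  by (induction A rule: infinite_finite_induct)
    (simp_all only: sum.infinite sum.empty sum.insert inner_Rn_add inner_Rn_0 not_False_eq_True)

lemma inner_Rn_pos:
  assumes "x \<in> Rn n" "x \<noteq> 0"
  shows "inner_Rn n x x > 0"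
proof -
  obtain i where i: "x i \<noteq> 0"
    using assms(2) by (auto simp: fun_eq_iff)
  then have "i < n"
    using assms(1) unfolding topspace_Euclidean_space by (metis (mono_tags) mem_Collect_eq not_less)
  then have "0 < x i * x i" "x i * x i \<le> inner_Rn n x x"
    using i unfolding inner_Rn_def
    by (auto simp: zero_less_mult_iff intro!: member_le_sum[where f = "\<lambda>i. x i * x i"])
  then show ?thesis by linarith
qed

lemma orthonormal_basis_span:
  assumes "finite B" "B \<subseteq> Rn n"
  shows "\<exists>k b. orthonormal_basis n k b (span B)"
  using assms
proof (induction B rule: finite_induct)
  case empty
  have "orthonormal_basis n 0 (\<lambda>_ _. 0) (span {})"
    by (simp add: orthonormal_basis_def)
  then show ?case by blast
next
  case (insert x B)
  then obtain k b where "orthonormal_basis n k b (span B)" by auto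
  then have b: "\<And>j. j < k \<Longrightarrow> b j \<in> Rn n"
    "\<And>i j. i < k \<Longrightarrow> j < k \<Longrightarrow> inner_Rn n (b i) (b j) = (if i = j then 1 else 0)"
    "span (b ` {..<k}) = span B"
    by (simp_all add: orthonormal_basis_def)
  define p where "p = (\<Sum>j<k. inner_Rn n x (b j) *\<^sub>R b j)"
  define y where "y = x - p"
  have p: "p \<in> span (b ` {..<k})"
    unfolding p_def by (intro span_sum span_scale span_base) auto
  have "p \<in> Rn n"
    unfolding p_def using b(1) by (intro subspace_sum subspace_scale subspace_Rn) auto
  then have y: "y \<in> Rn n"
    unfolding y_def using insert.prems by (intro subspace_diff subspace_Rn) auto
  have y_orth: "inner_Rn n y (b j) = 0" if "j < k" for j
  proof -
    have "inner_Rn n p (b j) = (\<Sum>i<k. if i = j then inner_Rn n x (b i) else 0)"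
      unfolding p_def inner_Rn_sum inner_Rn_scale
      by (rule sum.cong) (use b(2) that in auto)
    then show ?thesis
      using that by (simp add: y_def inner_Rn_diff)
  qed
  have "insert x B \<subseteq> span (insert y (b ` {..<k}))"
  proof -
    have "x = y + p" by (simp add: y_def)
    moreover have "y + p \<in> span (insert y (b ` {..<k}))"
      using p span_mono[of "b ` {..<k}" "insert y (b ` {..<k})"]
      by (intro span_add) (auto intro: span_base)
    moreover have "B \<subseteq> span (insert y (b ` {..<k}))"
      using b(3) span_superset[of B] span_mono[of "b ` {..<k}" "insert y (b ` {..<k})"] by auto
    ultimately show ?thesis by auto
  qed
  moreover have "insert y (b ` {..<k}) \<subseteq> span (insert x B)"
  proof -
    have sub: "span (b ` {..<k}) \<subseteq> span (insert x B)"
      unfolding b(3) by (rule span_mono) auto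
    then have "y \<in> span (insert x B)"
      unfolding y_def using p by (intro span_diff) (auto intro: span_base)
    then show ?thesis
      using sub span_superset[of "b ` {..<k}"] by auto
  qed
  ultimately have spn: "span (insert y (b ` {..<k})) = span (insert x B)"
    by (metis span_mono span_span subset_antisym)
  show ?case
  proof (cases "y = 0")
    case True
    then have "orthonormal_basis n k b (span (insert x B))"
      using b spn unfolding orthonormal_basis_def by (simp add: span_insert_0)
    then show ?thesis by blast
  next
    case False
    define r where "r = sqrt (inner_Rn n y y)"
    have r: "r > 0" "r * r = inner_Rn n y y"
      using inner_Rn_pos[OF y False] by (auto simp: r_def)
    define u where "u = (1 / r) *\<^sub>R y"
    define b' where "b' = (\<lambda>j. if j < k then b j else u)"
    have "u \<in> Rn n"
      unfolding u_def using y by (intro subspace_scale subspace_Rn)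
    moreover have "inner_Rn n u u = 1"
    proof -
      have "inner_Rn n u u = (1 / r) * ((1 / r) * (r * r))"
        unfolding u_def by (metis inner_Rn_scale inner_Rn_commute r(2))
      then show ?thesis using r(1) by simp
    qed
    moreover have "inner_Rn n u (b j) = 0" "inner_Rn n (b j) u = 0" if "j < k" for j
      using y_orth[OF that] by (simp_all add: u_def inner_Rn_scale inner_Rn_commute[of n "b j"])
    moreover have "span (b' ` {..<Suc k}) = span (insert x B)"
    proof -
      have "b' ` {..<Suc k} = insert u (b ` {..<k})"
        by (auto simp: b'_def lessThan_Suc)
      moreover have "y = r *\<^sub>R u" using r by (simp add: u_def)
      moreover have "insert u (b ` {..<k}) \<subseteq> span (insert y (b ` {..<k}))"
        unfolding u_def by (auto intro: span_base span_scale)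
      moreover have "insert y (b ` {..<k}) \<subseteq> span (insert u (b ` {..<k}))"
        unfolding \<open>y = r *\<^sub>R u\<close> by (auto intro: span_base span_scale)
      ultimately show ?thesis
        by (metis span_mono span_span spn subset_antisym)
    qed
    ultimately have "orthonormal_basis n (Suc k) b' (span (insert x B))"
      using b unfolding orthonormal_basis_def by (auto simp: b'_def less_Suc_eq)
    then show ?thesis by blast
  qed
qed

lemma dim_orthonormal_basis:
  assumes "orthonormal_basis n m b H"
  shows "dim H = m"
proof -
  have b: "inner_Rn n (b i) (b j) = (if i = j then 1 else 0)" if "i < m" "j < m" for i j
    using assms that by (auto simp: orthonormal_basis_def)
  have inj: "inj_on b {..<m}"
    by (rule inj_onI) (metis b lessThan_iff zero_neq_one)
  have "independent (b ` {..<m})"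
    unfolding independent_explicit_module
  proof (intro allI impI)
    fix T u v
    assume T: "finite T" "T \<subseteq> b ` {..<m}" and 0: "(\<Sum>v\<in>T. u v *\<^sub>R v) = 0" and "v \<in> T"
    then obtain j where j: "j < m" "v = b j" by auto
    have "0 = inner_Rn n (\<Sum>v\<in>T. u v *\<^sub>R v) v"
      unfolding 0 by (simp add: inner_Rn_def)
    also have "\<dots> = (\<Sum>w\<in>T. u w * inner_Rn n w v)"
      by (simp add: inner_Rn_sum inner_Rn_scale)
    also have "\<dots> = (\<Sum>w\<in>T. if w = v then u w else 0)"
    proof (rule sum.cong)
      fix w assume "w \<in> T"
      then obtain i where "i < m" "w = b i" using T by auto
      then show "u w * inner_Rn n w v = (if w = v then u w else 0)"
        using b j inj by (auto simp: inj_on_eq_iff)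
    qed simp
    also have "\<dots> = u v" using T \<open>v \<in> T\<close> by simp
    finally show "u v = 0" ..
  qed
  moreover have "span (b ` {..<m}) = H"
    using assms by (simp add: orthonormal_basis_def)
  ultimately show ?thesis
    using inj by (metis card_image card_lessThan dim_span_eq_card_independent)
qed

lemma ex_orthonormal_basis:
  assumes "subspace H" "H \<subseteq> Rn n"
  shows "\<exists>b. orthonormal_basis n (dim H) b H"
proof -
  obtain B where B: "B \<subseteq> H" "independent B" "H \<subseteq> span B"
    using maximal_independent_subset by blast
  have "finite B"
    using independent_span_bound[of "(\<lambda>i j. if j = i then 1 else 0) ` {..<n}" B] B assms(2) Rn_eq_span
    by blast
  moreover have "span B = H"
    using B assms(1) span_minimal by blast
  ultimately obtain k b where "orthonormal_basis n k b H"
    using orthonormal_basis_span[of B n] B assms(2) by auto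
  then show ?thesis
    using dim_orthonormal_basis by blast
qed

lemma measurable_lborel_Rn_map:
  "(\<lambda>x i. if i < n then x i else 0) \<in> Pi\<^sub>M {..<n} (\<lambda>_. lborel) \<rightarrow>\<^sub>M restrict_space borel (Rn n)"
  for n :: nat
proof (rule measurable_restrict_space2)
  show "(\<lambda>x i. if i < n then x i else 0) \<in> Pi\<^sub>M {..<n} (\<lambda>_. lborel) \<rightarrow>\<^sub>M (borel :: (nat \<Rightarrow> real) measure)"
  proof (rule measurable_coordinatewise_then_product)
    fix i
    show "(\<lambda>x. if i < n then x i else (0::real)) \<in> borel_measurable (Pi\<^sub>M {..<n} (\<lambda>_. lborel))"
      by (cases "i < n") (auto intro: measurable_compose[OF measurable_component_singleton[of i]])
  qed
qed (auto simp: topspace_Euclidean_space)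

lemma measurable_lborel_subspace_map:
  assumes "orthonormal_basis n m b H"
  shows "(\<lambda>c. \<Sum>j<m. c j *\<^sub>R b j) \<in> lborel_Rn m \<rightarrow>\<^sub>M restrict_space borel H"
proof (rule measurable_restrict_space2)
  have "(\<lambda>c. \<Sum>j<m. c j *\<^sub>R b j) \<in> (borel :: (nat \<Rightarrow> real) measure) \<rightarrow>\<^sub>M borel"
  proof (rule measurable_coordinatewise_then_product)
    fix i
    show "(\<lambda>c. (\<Sum>j<m. c j *\<^sub>R b j) i) \<in> borel_measurable borel"
      unfolding sum_fun_apply scaleR_fun_def
      by (intro borel_measurable_sum borel_measurable_scaleR borel_measurable_const
            measurable_product_coordinates)
  qed
  then show "(\<lambda>c. \<Sum>j<m. c j *\<^sub>R b j) \<in> lborel_Rn m \<rightarrow>\<^sub>M borel"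
    unfolding lborel_Rn_def measurable_distr_eq1 by (rule measurable_restrict_space1)
  have "(\<Sum>j<m. c j *\<^sub>R b j) \<in> span (b ` {..<m})" for c
    by (intro span_sum span_scale span_base) auto
  then show "(\<lambda>c. \<Sum>j<m. c j *\<^sub>R b j) \<in> space (lborel_Rn m) \<rightarrow> H"
    using assms by (auto simp: orthonormal_basis_def)
qed

end

theory Submission
  imports Defs
begin

text \<open>
  Let \<open>K\<close> be the support of \<open>f\<close>, \<open>U\<close> its interior and \<open>D = U - U\<close>.
  If \<open>x \<in> l D\<close> with \<open>0 < l < 1\<close>, then \<open>U \<inter> (U - x)\<close> contains a translate of \<open>(1 - l) U\<close>, so its
  volume is at least \<open>(1 - l)^n\<close> times that of \<open>U\<close>. Integrating this volume over \<open>x \<in> H\<close> against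
  \<open>\<mu>\<close> and exchanging the integrals gives
  \<open>(1 - l)^n l^m \<mu>(D \<inter> H) \<le> sup \<mu>((U - a) \<inter> H)\<close> over \<open>a \<in> U\<close>; the factor \<open>l^m\<close> comes from
  the radial monotonicity of the density. With \<open>l = m / (n + m)\<close> this is a Rogers--Shephard inequality
  with constant \<open>(C n / m)^m\<close>.

  Since \<open>f\<close> is maximal at the origin, the function \<open>\<Delta>f\<close> is at most \<open>2^s f(0)\<close> times the indicator of
  \<open>K - K \<subseteq> 2 D\<close>. Conversely \<open>f(x + a/2) \<ge> 2^(-s) f(0)\<close> when \<open>2 x + a \<in> U\<close>, so
  \<open>\<mu>((U - a) \<inter> H)\<close> is at most \<open>2^(m + s) / f(0)\<close> times the integral of \<open>f(x + a/2)\<close> over \<open>H\<close>.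
  Working with the open set \<open>U\<close> and dilations by 2 avoids all measurability questions about \<open>f\<close> and \<open>K\<close>.
\<close>

section \<open>Lebesgue measure on \<open>Rn n\<close>: affine substitution and
  sigma-finiteness\<close>

lemmas fun_vec = func_plus fun_diff_def scaleR_fun_def

lemma space_lborel_Rn [simp]: "space (lborel_Rn n) = Rn n"
  by (simp add: lborel_Rn_def space_restrict_space)

lemma sets_lborel_Rn [measurable_cong]: "sets (lborel_Rn n) = sets (restrict_space borel (Rn n))"
  by (simp add: lborel_Rn_def)

interpretation lborel_prod: product_sigma_finite "\<lambda>_::nat. lborel :: real measure" ..

text \<open>A product measure is determined by its values on boxes, and on a box each of the
  \<open>n\<close> coordinates contributes one factor \<open>c\<close> by the one-dimensional
  \<open>lborel_real_affine\<close>. Stated as an equality of measures, it can be substituted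
  directly for the measure of an integral.\<close>

lemma lborel_PiM_affine:
  fixes c :: real and t :: "nat \<Rightarrow> real"
  assumes c: "c > 0"
  shows "scale_measure (ennreal (c ^ n)) (distr (Pi\<^sub>M {..<n} (\<lambda>_. lborel)) (Pi\<^sub>M {..<n} (\<lambda>_. lborel))
           (\<lambda>x. \<lambda>i\<in>{..<n}. t i + c * x i)) = Pi\<^sub>M {..<n} (\<lambda>_. lborel)"
proof (rule lborel_prod.PiM_eqI)
  fix A :: "nat \<Rightarrow> real set"
  assume A: "\<And>i. i \<in> {..<n} \<Longrightarrow> A i \<in> sets lborel"
  let ?P = "Pi\<^sub>M {..<n} (\<lambda>_::nat. lborel :: real measure)"
  let ?T = "\<lambda>x. \<lambda>i\<in>{..<n}. t i + c * x i :: real"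
  have T: "?T \<in> ?P \<rightarrow>\<^sub>M ?P"
    by measurable
  let ?B = "\<lambda>i. (\<lambda>x. t i + c * x) -` A i"
  have B: "?B i \<in> sets lborel" if "i < n" for i
  proof -
    have "(\<lambda>x. t i + c * x) -` A i \<inter> space borel \<in> sets borel"
      by (rule measurable_sets[of _ borel borel]) (use A[of i] that in auto)
    then show ?thesis by simp
  qed
  have one: "emeasure lborel (A i) = ennreal c * emeasure lborel (?B i)" if "i < n" for i
  proof -
    have "emeasure lborel (A i) = emeasure (density (distr lborel borel (\<lambda>x. t i + c * x)) (\<lambda>_. ennreal c)) (A i)"
      using lborel_real_affine[of c "t i"] c by simp
    also have "\<dots> = ennreal c * emeasure (distr lborel borel (\<lambda>x. t i + c * x)) (A i)"
      using A[of i] that by (simp add: emeasure_density_const)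
    also have "\<dots> = ennreal c * emeasure lborel (?B i)"
      using A[of i] that by (subst emeasure_distr) auto
    finally show ?thesis .
  qed
  have vim: "?T -` Pi\<^sub>E {..<n} A \<inter> space ?P = Pi\<^sub>E {..<n} ?B"
    by (auto simp: space_PiM PiE_iff extensional_def)
  have "emeasure (distr ?P ?P ?T) (Pi\<^sub>E {..<n} A) = emeasure ?P (Pi\<^sub>E {..<n} ?B)"
    using A by (subst emeasure_distr[OF T]) (auto simp: vim)
  also have "\<dots> = (\<Prod>i<n. emeasure lborel (?B i))"
    using B by (subst lborel_prod.emeasure_PiM) auto
  finally have *: "emeasure (distr ?P ?P ?T) (Pi\<^sub>E {..<n} A) = (\<Prod>i<n. emeasure lborel (?B i))" .
  have "(\<Prod>i<n. emeasure lborel (A i)) = (\<Prod>i<n. ennreal c * emeasure lborel (?B i))"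
    by (rule prod.cong) (use one in auto)
  also have "\<dots> = ennreal (c ^ n) * (\<Prod>i<n. emeasure lborel (?B i))"
    using c by (simp add: prod.distrib ennreal_power)
  finally show "emeasure (scale_measure (ennreal (c ^ n)) (distr ?P ?P ?T)) (Pi\<^sub>E {..<n} A)
      = (\<Prod>i\<in>{..<n}. emeasure lborel (A i))"
    by (simp add: *)
qed auto

lemma nn_integral_lborel_Rn:
  assumes "F \<in> borel_measurable (lborel_Rn n)"
  shows "(\<integral>\<^sup>+x. F x \<partial>lborel_Rn n) = (\<integral>\<^sup>+x. F (\<lambda>i. if i < n then x i else 0) \<partial>Pi\<^sub>M {..<n} (\<lambda>_. lborel))"
  using assms unfolding lborel_Rn_def
  by (intro nn_integral_distr measurable_lborel_Rn_map) (simp add: measurable_distr_eq1)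

lemma continuous_affine_fun: "continuous_on UNIV (\<lambda>x::nat \<Rightarrow> real. t + c *\<^sub>R x)"
  unfolding fun_vec
  by (intro continuous_on_coordinatewise_then_product continuous_intros continuous_on_product_coordinates)

lemma measurable_affine_restrict:
  fixes S :: "(nat \<Rightarrow> real) set"
  assumes "subspace S" "t \<in> S"
  shows "(\<lambda>x. t + c *\<^sub>R x) \<in> restrict_space borel S \<rightarrow>\<^sub>M restrict_space borel S"
proof (rule measurable_restrict_space2)
  show "(\<lambda>x. t + c *\<^sub>R x) \<in> restrict_space borel S \<rightarrow>\<^sub>M borel"
    by (intro measurable_restrict_space1 borel_measurable_continuous_onI continuous_affine_fun)
qed (use assms in \<open>auto simp: space_restrict_space intro: subspace_add subspace_scale\<close>)

lemma nn_integral_lborel_Rn_affine: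
  assumes F: "F \<in> borel_measurable (lborel_Rn n)" and c: "c > 0" and t: "t \<in> Rn n"
  shows "(\<integral>\<^sup>+x. F x \<partial>lborel_Rn n) = ennreal (c ^ n) * (\<integral>\<^sup>+x. F (t + c *\<^sub>R x) \<partial>lborel_Rn n)"
proof -
  let ?P = "Pi\<^sub>M {..<n} (\<lambda>_::nat. lborel :: real measure)"
  let ?e = "\<lambda>(x::nat \<Rightarrow> real) i. if i < n then x i else 0"
  let ?T = "\<lambda>x. \<lambda>i\<in>{..<n}. t i + c * x i :: real"
  have T: "?T \<in> ?P \<rightarrow>\<^sub>M ?P"
    by measurable
  have e: "?e \<in> ?P \<rightarrow>\<^sub>M lborel_Rn n"
    using measurable_lborel_Rn_map[of n] by (simp add: lborel_Rn_def)
  have G: "(\<lambda>x. F (?e x)) \<in> borel_measurable ?P"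
    by (rule measurable_compose[OF e F])
  have "(\<lambda>x. t + c *\<^sub>R x) \<in> lborel_Rn n \<rightarrow>\<^sub>M lborel_Rn n"
    using measurable_affine_restrict[OF subspace_Rn t] sets_lborel_Rn
    by (simp cong: measurable_cong_sets)
  from measurable_compose[OF this F] have F': "(\<lambda>x. F (t + c *\<^sub>R x)) \<in> borel_measurable (lborel_Rn n)" .
  have "(\<integral>\<^sup>+x. F x \<partial>lborel_Rn n) = (\<integral>\<^sup>+x. F (?e x) \<partial>scale_measure (ennreal (c ^ n)) (distr ?P ?P ?T))"
    unfolding lborel_PiM_affine[OF c] by (rule nn_integral_lborel_Rn[OF F])
  also have "\<dots> = ennreal (c ^ n) * (\<integral>\<^sup>+x. F (?e (?T x)) \<partial>?P)"
    using G T by (simp add: nn_integral_scale_measure nn_integral_distr)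
  \<comment> \<open>Padding by zeros commutes with the affine map because \<open>t\<close>, lying in
    \<open>Rn n\<close>, vanishes at all indices from \<open>n\<close> on.\<close>
  also have "(\<lambda>x. F (?e (?T x))) = (\<lambda>x. F (t + c *\<^sub>R ?e x))"
    using t by (auto simp: fun_vec fun_eq_iff topspace_Euclidean_space intro!: arg_cong[of _ _ F])
  finally show ?thesis
    using nn_integral_lborel_Rn[OF F'] by simp
qed

lemma coordinate_measurable_lborel_Rn: "(\<lambda>x. x i) \<in> borel_measurable (lborel_Rn n)"
proof -
  have "(\<lambda>x::nat \<Rightarrow> real. x i) \<in> borel_measurable (restrict_space borel (Rn n))"
    by (intro measurable_restrict_space1 measurable_product_coordinates)
  then show ?thesis
    using sets_lborel_Rn by (simp cong: measurable_cong_sets)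
qed

text \<open>Restricting to the first \<open>n\<close> coordinates undoes the zero padding, so the
  image of \<open>lborel_Rn n\<close> under it is the sigma-finite product measure. Sigma-finiteness
  passes back from an image measure to its source. It is needed for the exchange of
  integrals.\<close>

lemma sigma_finite_lborel_Rn: "sigma_finite_measure (lborel_Rn n)"
proof -
  let ?P = "Pi\<^sub>M {..<n} (\<lambda>_::nat. lborel :: real measure)"
  interpret P: sigma_finite_measure ?P
    by (rule lborel_prod.sigma_finite) simp
  let ?r = "\<lambda>x::nat \<Rightarrow> real. \<lambda>i\<in>{..<n}. x i"
  have m: "?r \<in> lborel_Rn n \<rightarrow>\<^sub>M ?P"
    by (rule measurable_restrict) (simp add: coordinate_measurable_lborel_Rn)
  then have r: "?r \<in> restrict_space borel (Rn n) \<rightarrow>\<^sub>M ?P"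
    using sets_lborel_Rn by (simp cong: measurable_cong_sets)
  have "distr (lborel_Rn n) ?P ?r = distr ?P ?P (?r \<circ> (\<lambda>x i. if i < n then x i else 0))"
    unfolding lborel_Rn_def by (rule distr_distr[OF r measurable_lborel_Rn_map])
  also have "\<dots> = distr ?P ?P (\<lambda>x. x)"
    by (rule distr_cong) (auto simp: space_PiM PiE_def extensional_def fun_eq_iff)
  also have "\<dots> = ?P"
    by (rule distr_id2) simp
  finally have "sigma_finite_measure (distr (lborel_Rn n) ?P ?r)"
    by (simp only: P.sigma_finite_measure_axioms)
  then show ?thesis
    using m by (rule sigma_finite_measure_distr)
qed

section \<open>Lebesgue measure on a subspace\<close>

locale subspace_Rn =
  fixes n :: nat and H :: "(nat \<Rightarrow> real) set"
  assumes H_sub: "H \<subseteq> Rn n" and subspace_H: "subspace H"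
begin

text \<open>This is literally the choice made inside \<open>lborel_subspace\<close>, so that this
  measure unfolds to an image under \<open>param\<close>.\<close>

definition basis :: "nat \<Rightarrow> nat \<Rightarrow> real" where
  "basis = (SOME b. orthonormal_basis n (dim H) b H)"

definition param :: "(nat \<Rightarrow> real) \<Rightarrow> nat \<Rightarrow> real" where
  "param c = (\<Sum>j<dim H. c j *\<^sub>R basis j)"

lemma basis: "orthonormal_basis n (dim H) basis H"
  unfolding basis_def by (rule someI_ex[OF ex_orthonormal_basis[OF subspace_H H_sub]])

lemma lborel_subspace_eq: "lborel_subspace n H = distr (lborel_Rn (dim H)) (restrict_space borel H) param"
  unfolding lborel_subspace_def Let_def basis_def[symmetric] param_def[abs_def] ..

lemma param_measurable: "param \<in> lborel_Rn (dim H) \<rightarrow>\<^sub>M restrict_space borel H"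
  using measurable_lborel_subspace_map[OF basis] by (simp add: param_def[abs_def])

lemma space_lborel_subspace [simp]: "space (lborel_subspace n H) = H"
  by (simp add: lborel_subspace_eq space_restrict_space)

lemma sets_lborel_subspace: "sets (lborel_subspace n H) = sets (restrict_space borel H)"
  by (simp add: lborel_subspace_eq)

text \<open>The pull-back argument of \<open>sigma_finite_lborel_Rn\<close> applies again: by
  orthonormality, the inner products with the basis vectors recover the coefficients, so
  \<open>?g\<close> is a left inverse of \<open>param\<close> on \<open>Rn ?m\<close>.\<close>

lemma sigma_finite_lborel_subspace: "sigma_finite_measure (lborel_subspace n H)"
proof -
  let ?m = "dim H"
  let ?R = "lborel_Rn ?m"
  let ?g = "\<lambda>x j. if j < ?m then inner_Rn n x (basis j) else 0"
  interpret R: sigma_finite_measure ?R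
    by (rule sigma_finite_lborel_Rn)
  have "?g \<in> restrict_space borel H \<rightarrow>\<^sub>M restrict_space borel (Rn ?m)"
  proof (intro measurable_restrict_space2 measurable_restrict_space1 measurable_coordinatewise_then_product)
    fix j
    show "(\<lambda>x. if j < ?m then inner_Rn n x (basis j) else 0) \<in> borel_measurable borel"
      unfolding inner_Rn_def
      by (cases "j < ?m") (auto intro!: borel_measurable_sum borel_measurable_times measurable_product_coordinates)
  qed (auto simp: topspace_Euclidean_space)
  then have g: "?g \<in> restrict_space borel H \<rightarrow>\<^sub>M ?R"
    using sets_lborel_Rn by (simp cong: measurable_cong_sets)
  have inv: "?g (param c) = c" if "c \<in> Rn ?m" for c
  proof
    fix j
    show "?g (param c) j = c j"
    proof (cases "j < ?m")
      case True
      have "inner_Rn n (param c) (basis j) = (\<Sum>i<?m. if i = j then c i else 0)"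
        unfolding param_def inner_Rn_sum inner_Rn_scale
        by (rule sum.cong) (use basis True in \<open>auto simp: orthonormal_basis_def\<close>)
      then show ?thesis using True by simp
    qed (use that in \<open>simp add: topspace_Euclidean_space\<close>)
  qed
  have "distr (lborel_subspace n H) ?R ?g = distr ?R ?R (?g \<circ> param)"
    unfolding lborel_subspace_eq by (rule distr_distr[OF g param_measurable])
  also have "\<dots> = distr ?R ?R (\<lambda>x. x)"
    by (rule distr_cong) (simp_all only: o_def inv space_lborel_Rn)
  also have "\<dots> = ?R"
    by (rule distr_id2) simp
  finally have "sigma_finite_measure (distr (lborel_subspace n H) ?R ?g)"
    by (simp only: R.sigma_finite_measure_axioms)
  moreover have "?g \<in> lborel_subspace n H \<rightarrow>\<^sub>M ?R"
    using g sets_lborel_subspace by (simp cong: measurable_cong_sets)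
  ultimately show ?thesis
    by (rule sigma_finite_measure_distr)
qed

text \<open>Since \<open>param\<close> is linear, dilating \<open>H\<close> amounts to dilating the
  coefficient space of dimension \<open>dim H\<close>; this explains the exponent.\<close>

lemma nn_integral_lborel_subspace_scale:
  assumes F: "F \<in> borel_measurable (restrict_space borel H)" and c: "c > 0"
  shows "(\<integral>\<^sup>+x. F x \<partial>lborel_subspace n H) = ennreal (c ^ dim H) * (\<integral>\<^sup>+x. F (c *\<^sub>R x) \<partial>lborel_subspace n H)"
proof -
  let ?R = "lborel_Rn (dim H)"
  have param_scale: "param (c *\<^sub>R x) = c *\<^sub>R param x" for x
    by (simp add: param_def scaleR_sum_right scaleR_fun_def mult.assoc sum_fun_apply fun_eq_iff sum_distrib_left)
  have "(\<lambda>x. F (c *\<^sub>R x)) \<in> borel_measurable (restrict_space borel H)"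
    using measurable_compose[OF measurable_affine_restrict[OF subspace_H subspace_0[OF subspace_H], of c] F]
    by simp
  then have "(\<integral>\<^sup>+x. F (c *\<^sub>R x) \<partial>lborel_subspace n H) = (\<integral>\<^sup>+x. F (c *\<^sub>R param x) \<partial>?R)"
    unfolding lborel_subspace_eq by (intro nn_integral_distr param_measurable) (simp add: measurable_distr_eq1)
  moreover have "(\<integral>\<^sup>+x. F x \<partial>lborel_subspace n H) = (\<integral>\<^sup>+x. F (param x) \<partial>?R)"
    using F unfolding lborel_subspace_eq by (intro nn_integral_distr param_measurable) (simp add: measurable_distr_eq1)
  moreover have "\<dots> = ennreal (c ^ dim H) * (\<integral>\<^sup>+x. F (param (0 + c *\<^sub>R x)) \<partial>?R)"
    by (rule nn_integral_lborel_Rn_affine[OF measurable_compose[OF param_measurable F] c subspace_0[OF subspace_Rn]])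
  moreover have "param (0 + c *\<^sub>R x) = c *\<^sub>R param x" for x
    using param_scale by simp
  ultimately show ?thesis by simp
qed

end

section \<open>Open sets and interiors of convex sets in \<open>Rn n\<close>\<close>

lemma convex_iff_segment:
  "convex U \<longleftrightarrow> (\<forall>u\<in>U. \<forall>v\<in>U. \<forall>t\<in>{0..1}. (1 - t) *\<^sub>R u + t *\<^sub>R v \<in> U)"
  by (auto simp: convex_alt)

text \<open>This links the library's \<open>Euclidean_space\<close> to the type class topology on
  \<open>nat \<Rightarrow> real\<close>, in which the Borel sets and continuity facts are
  formulated.\<close>

lemma openin_Euclidean_space_iff: "openin (Euclidean_space n) U \<longleftrightarrow> (\<exists>W. open W \<and> U = W \<inter> Rn n)"
proof -
  have "openin (Euclidean_space n) U
      \<longleftrightarrow> (\<exists>W. openin (powertop_real UNIV) W \<and> U = W \<inter> {x. \<forall>i\<ge>n. x i = 0})"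
    unfolding Euclidean_space_def by (rule openin_subtopology)
  then show ?thesis
    unfolding topspace_Euclidean_space by (simp only: euclidean_product_topology open_openin[symmetric])
qed

lemma openin_affine_vimage:
  assumes U: "openin (Euclidean_space n) U" and t: "t \<in> Rn n"
  shows "openin (Euclidean_space n) {x \<in> Rn n. t + c *\<^sub>R x \<in> U}"
proof -
  obtain W where W: "open W" "U = W \<inter> Rn n"
    using U by (auto simp: openin_Euclidean_space_iff)
  have "open ((\<lambda>x. t + c *\<^sub>R x) -` W)"
    using W(1) continuous_affine_fun by (intro open_vimage)
  moreover have "{x \<in> Rn n. t + c *\<^sub>R x \<in> U} = (\<lambda>x. t + c *\<^sub>R x) -` W \<inter> Rn n"
    using W(2) t subspace_Rn by (auto intro: subspace_add subspace_scale)
  ultimately show ?thesis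
    by (auto simp: openin_Euclidean_space_iff)
qed

lemma openin_borel:
  assumes "openin (Euclidean_space n) U"
  shows "U \<in> sets (lborel_Rn n)"
proof -
  obtain W where "open W" "U = Rn n \<inter> W"
    using assms unfolding openin_Euclidean_space_iff by (metis Int_commute)
  then show ?thesis
    by (simp add: sets_lborel_Rn sets_restrict_space)
qed

text \<open>Solving \<open>y = (1 - t) v + t k\<close> for \<open>v\<close> gives an affine map of
  \<open>y\<close>. The preimage of the interior under this map is open, lies in \<open>K\<close> by
  convexity, and contains the point in question.\<close>

lemma convex_interior_combine:
  assumes K: "convex K" "K \<subseteq> Rn n"
    and u: "u \<in> Euclidean_space n interior_of K" and k: "k \<in> K" and t: "0 \<le> t" "t < 1"
  shows "(1 - t) *\<^sub>R u + t *\<^sub>R k \<in> Euclidean_space n interior_of K"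
proof -
  let ?V = "Euclidean_space n interior_of K"
  let ?t = "(- (t / (1 - t))) *\<^sub>R k" and ?c = "1 / (1 - t)"
  let ?W = "{y \<in> Rn n. ?t + ?c *\<^sub>R y \<in> ?V}"
  have "u \<in> Rn n" "k \<in> Rn n"
    using u k K(2) interior_of_subset[of "Euclidean_space n" K] by auto
  moreover from this have "?t \<in> Rn n"
    by (intro subspace_scale subspace_Rn)
  ultimately have Rn: "u \<in> Rn n" "k \<in> Rn n" "?t \<in> Rn n" .
  have "openin (Euclidean_space n) ?W"
    by (rule openin_affine_vimage[OF openin_interior_of Rn(3)])
  moreover have "?W \<subseteq> K"
  proof
    fix y assume y: "y \<in> ?W"
    let ?v = "?t + ?c *\<^sub>R y"
    have "?v \<in> K"
      using y interior_of_subset[of "Euclidean_space n" K] by auto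
    then have "(1 - t) *\<^sub>R ?v + t *\<^sub>R k \<in> K"
      using K(1) k t by (auto simp: convex_iff_segment)
    also have "(1 - t) *\<^sub>R ?v + t *\<^sub>R k = y"
      using t by (simp add: scaleR_add_right scaleR_diff_right)
    finally show "y \<in> K" .
  qed
  moreover have "(1 - t) *\<^sub>R u + t *\<^sub>R k \<in> ?W"
  proof -
    have "?t + ?c *\<^sub>R ((1 - t) *\<^sub>R u + t *\<^sub>R k) = u"
      using t by (simp add: scaleR_add_right)
    then show ?thesis
      using u Rn subspace_Rn by (auto intro: subspace_add subspace_scale)
  qed
  ultimately show ?thesis
    using interior_of_maximal by blast
qed

lemma convex_interior:
  assumes "convex K" "K \<subseteq> Rn n"
  shows "convex (Euclidean_space n interior_of K)"
  unfolding convex_iff_segment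
proof (intro ballI)
  fix u v and t :: real
  assume *: "u \<in> Euclidean_space n interior_of K" "v \<in> Euclidean_space n interior_of K" "t \<in> {0..1}"
  have v: "v \<in> K"
    using * interior_of_subset[of "Euclidean_space n" K] by auto
  show "(1 - t) *\<^sub>R u + t *\<^sub>R v \<in> Euclidean_space n interior_of K"
  proof (cases "t = 1")
    case True
    then show ?thesis using * by simp
  next
    case False
    then show ?thesis
      using convex_interior_combine[OF assms *(1) v, of t] *(3) by auto
  qed
qed

section \<open>Cubes and the positive volume of open sets\<close>

definition cube :: "nat \<Rightarrow> real \<Rightarrow> (nat \<Rightarrow> real) set" where
  "cube n R = {x \<in> Rn n. \<forall>i<n. \<bar>x i\<bar> < R}"

lemma openin_cube: "openin (Euclidean_space n) (cube n R)"
proof -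
  have "open (\<Inter>i\<in>{..<n}. {x::nat \<Rightarrow> real. \<bar>x i\<bar> < R})"
    by (intro open_INT open_Collect_less finite_lessThan ballI continuous_intros
          continuous_on_product_coordinates)
  then show ?thesis
    unfolding openin_Euclidean_space_iff
    by (intro exI[of _ "\<Inter>i\<in>{..<n}. {x. \<bar>x i\<bar> < R}"] conjI) (auto simp: cube_def)
qed

lemma convex_cube: "convex (cube n R)"
  unfolding convex_iff_segment
proof (intro ballI)
  fix u v and t :: real
  assume *: "u \<in> cube n R" "v \<in> cube n R" "t \<in> {0..1}"
  then have "(1 - t) *\<^sub>R u + t *\<^sub>R v \<in> Rn n"
    using subspace_Rn by (auto simp: cube_def intro: subspace_add subspace_scale)
  moreover have "\<bar>((1 - t) *\<^sub>R u + t *\<^sub>R v) i\<bar> < R" if "i < n" for i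
  proof -
    have "u i \<in> {- R<..<R}" "v i \<in> {- R<..<R}"
      using that *(1,2) by (auto simp: cube_def abs_less_iff)
    then have "(1 - t) *\<^sub>R u i + t *\<^sub>R v i \<in> {- R<..<R}"
      using *(3) by (intro convexD_alt[OF convex_real_interval(8)]) auto
    then show ?thesis
      by (simp add: fun_vec abs_less_iff)
  qed
  ultimately show "(1 - t) *\<^sub>R u + t *\<^sub>R v \<in> cube n R"
    by (simp add: cube_def)
qed

lemma emeasure_cube: "emeasure (lborel_Rn n) (cube n R) = (\<Prod>i<n. emeasure lborel {- R <..< R})"
proof -
  let ?P = "Pi\<^sub>M {..<n} (\<lambda>_::nat. lborel :: real measure)"
  have "emeasure (lborel_Rn n) (cube n R)
      = emeasure ?P ((\<lambda>x i. if i < n then x i else 0) -` cube n R \<inter> space ?P)"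
    unfolding lborel_Rn_def
    by (rule emeasure_distr[OF measurable_lborel_Rn_map]) (use openin_borel[OF openin_cube] sets_lborel_Rn in auto)
  also have "(\<lambda>x i. if i < n then x i else 0) -` cube n R \<inter> space ?P = Pi\<^sub>E {..<n} (\<lambda>_. {- R <..< R})"
  proof -
    have "\<bar>y\<bar> < R \<longleftrightarrow> y \<in> {- R <..< R}" for y :: real
      by auto
    then show ?thesis
      by (simp add: cube_def space_PiM PiE_iff topspace_Euclidean_space set_eq_iff cong: conj_cong) blast
  qed
  finally show ?thesis
    by (simp add: lborel_prod.emeasure_PiM)
qed

text \<open>If \<open>U\<close> were a null set, then so would be its dilates
  \<open>(k + 1) (U - z)\<close>. These cover \<open>Rn n\<close>, which contains a cube of positive
  volume.\<close>

lemma emeasure_openin_pos: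
  assumes U: "openin (Euclidean_space n) U" and z: "z \<in> U"
  shows "emeasure (lborel_Rn n) U > 0"
proof (rule ccontr)
  assume "\<not> emeasure (lborel_Rn n) U > 0"
  then have 0: "emeasure (lborel_Rn n) U = 0" by simp
  have zR: "z \<in> Rn n"
    using U z openin_subset by blast
  let ?A = "\<lambda>k. {x \<in> Rn n. z + (1 / real (Suc k)) *\<^sub>R x \<in> U}"
  have A: "openin (Euclidean_space n) (?A k)" for k
    by (rule openin_affine_vimage[OF U zR])
  have "emeasure (lborel_Rn n) (?A k) = 0" for k
  proof -
    have "0 = (\<integral>\<^sup>+x. indicator U x \<partial>lborel_Rn n)"
      using 0 openin_borel[OF U] by simp
    also have "\<dots> = ennreal ((1 / real (Suc k)) ^ n) *
        (\<integral>\<^sup>+x. indicator U (z + (1 / real (Suc k)) *\<^sub>R x) \<partial>lborel_Rn n)"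
      by (rule nn_integral_lborel_Rn_affine) (use openin_borel[OF U] zR in auto)
    also have "(\<integral>\<^sup>+x. indicator U (z + (1 / real (Suc k)) *\<^sub>R x) \<partial>lborel_Rn n)
        = (\<integral>\<^sup>+x. indicator (?A k) x \<partial>lborel_Rn n)"
      by (rule nn_integral_cong) (auto split: split_indicator)
    also have "\<dots> = emeasure (lborel_Rn n) (?A k)"
      using openin_borel[OF A] by simp
    finally have "ennreal ((1 / real (Suc k)) ^ n) * emeasure (lborel_Rn n) (?A k) = 0" ..
    moreover have "ennreal ((1 / real (Suc k)) ^ n) \<noteq> 0"
      by (simp add: ennreal_eq_0_iff not_le)
    ultimately show ?thesis
      by simp
  qed
  then have "emeasure (lborel_Rn n) (\<Union>k. ?A k) = 0"
    using openin_borel[OF A] by (intro emeasure_UN_eq_0) auto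
  moreover have "(\<Union>k. ?A k) = Rn n"
  proof -
    \<comment> \<open>As \<open>c\<close> tends to 0, \<open>z + c x\<close> tends to
      \<open>z\<close>, so it eventually enters the open set around \<open>z\<close>.\<close>
    have "\<exists>k. z + (1 / real (Suc k)) *\<^sub>R x \<in> U" if x: "x \<in> Rn n" for x
    proof -
      obtain W where W: "open W" "U = W \<inter> Rn n"
        using U by (auto simp: openin_Euclidean_space_iff)
      have "continuous_on UNIV (\<lambda>c::real. z + c *\<^sub>R x)"
        unfolding fun_vec by (intro continuous_on_coordinatewise_then_product continuous_intros)
      then have "open ((\<lambda>c::real. z + c *\<^sub>R x) -` W)"
        using W(1) by (intro open_vimage)
      moreover have "0 \<in> (\<lambda>c::real. z + c *\<^sub>R x) -` W"
        using z W(2) by simp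
      ultimately have "\<forall>\<^sub>F c in nhds 0. c \<in> (\<lambda>c::real. z + c *\<^sub>R x) -` W"
        by (rule eventually_nhds_in_open)
      moreover have "(\<lambda>k. 1 / real (Suc k)) \<longlonglongrightarrow> 0"
        by (rule LIMSEQ_Suc[OF lim_1_over_n])
      ultimately have "\<forall>\<^sub>F k in sequentially. z + (1 / real (Suc k)) *\<^sub>R x \<in> W"
        by (auto dest: filterlim_iff[THEN iffD1, rule_format])
      then obtain k where "z + (1 / real (Suc k)) *\<^sub>R x \<in> W"
        by (auto simp: eventually_sequentially)
      moreover have "z + (1 / real (Suc k)) *\<^sub>R x \<in> Rn n"
        using zR x subspace_Rn by (intro subspace_add subspace_scale) auto
      ultimately show ?thesis using W(2) by auto
    qed
    then show ?thesis by auto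
  qed
  moreover have "emeasure (lborel_Rn n) (cube n 1) \<le> emeasure (lborel_Rn n) (Rn n)"
    by (rule emeasure_mono) (use sets.top[of "lborel_Rn n"] in \<open>auto simp: cube_def\<close>)
  ultimately show False
    by (simp add: emeasure_cube)
qed

section \<open>A Rogers-Shephard inequality for sections\<close>

lemma (in subspace_Rn) coordinate_measurable_lborel_subspace:
  "(\<lambda>x. x i) \<in> borel_measurable (lborel_subspace n H)"
proof -
  have "(\<lambda>x::nat \<Rightarrow> real. x i) \<in> borel_measurable (restrict_space borel H)"
    by (intro measurable_restrict_space1 measurable_product_coordinates)
  then show ?thesis
    using sets_lborel_subspace by (simp cong: measurable_cong_sets)
qed

text \<open>This is \<open>U - U\<close>, written as the set of those \<open>x\<close> for which
  \<open>U\<close> meets \<open>U - x\<close>; the witness \<open>b\<close> is a point of that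
  intersection.\<close>

definition difference_set :: "(nat \<Rightarrow> real) set \<Rightarrow> (nat \<Rightarrow> real) set" where
  "difference_set U = {x. \<exists>b\<in>U. b + x \<in> U}"

lemma openin_indicator_measurable:
  assumes "openin (Euclidean_space n) U" "H \<subseteq> Rn n"
  shows "(indicator U :: _ \<Rightarrow> ennreal) \<in> borel_measurable (restrict_space borel H)"
proof -
  obtain W where W: "open W" "U = W \<inter> Rn n"
    using assms(1) by (auto simp: openin_Euclidean_space_iff)
  have "(indicator W :: _ \<Rightarrow> ennreal) \<in> borel_measurable (restrict_space borel H)"
    using W(1) by (intro measurable_restrict_space1) simp
  moreover have "indicator U x = (indicator W x :: ennreal)" if "x \<in> space (restrict_space borel H)" for x
    using that W(2) assms(2) by (auto simp: space_restrict_space split: split_indicator)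
  ultimately show ?thesis
    by (subst measurable_cong)
qed

locale radial_density = subspace_Rn +
  fixes \<phi> :: "(nat \<Rightarrow> real) \<Rightarrow> real"
  assumes phi_measurable: "\<phi> \<in> borel_measurable (lborel_Rn n)"
    and phi_radial: "radially_decreasing n \<phi>"
begin

lemma phi_measurable_H: "\<phi> \<in> borel_measurable (restrict_space borel H)"
proof -
  have "\<phi> \<in> borel_measurable (restrict_space borel (Rn n))"
    using phi_measurable sets_lborel_Rn by (simp cong: measurable_cong_sets)
  then show ?thesis
    using H_sub by (rule measurable_restrict_mono)
qed

lemma phi_measurable_subspace: "\<phi> \<in> borel_measurable (lborel_subspace n H)"
  using phi_measurable_H sets_lborel_subspace by (simp cong: measurable_cong_sets)

lemma measurable_scale_H:
  assumes "F \<in> borel_measurable (restrict_space borel H)"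
  shows "(\<lambda>x. F (c *\<^sub>R x)) \<in> borel_measurable (restrict_space borel H)"
  using measurable_compose[OF measurable_affine_restrict[OF subspace_H subspace_0[OF subspace_H], of c] assms]
  by simp

lemma integral_on_mono:
  assumes "\<And>x. x \<in> H \<Longrightarrow> F x \<le> G x"
  shows "integral_on n \<phi> H F \<le> integral_on n \<phi> H G"
  unfolding integral_on_def using assms by (intro nn_integral_mono mult_right_mono) auto

lemma integral_on_cmult:
  assumes "F \<in> borel_measurable (restrict_space borel H)"
  shows "integral_on n \<phi> H (\<lambda>x. a * F x) = a * integral_on n \<phi> H F"
proof -
  have "(\<lambda>x. F x * ennreal (\<phi> x)) \<in> borel_measurable (lborel_subspace n H)"
    using assms phi_measurable_H sets_lborel_subspace by (simp cong: measurable_cong_sets)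
  then show ?thesis
    unfolding integral_on_def mult.assoc by (rule nn_integral_cmult)
qed

text \<open>The substitution contributes \<open>c ^ dim H\<close>. Since \<open>x\<close> is
  \<open>1 / c\<close> times \<open>c x\<close> and \<open>1 / c \<le> 1\<close>, radial
  monotonicity then allows the density at \<open>c x\<close> to be replaced by the density at
  \<open>x\<close>.\<close>

lemma integral_on_dilate:
  assumes F: "F \<in> borel_measurable (restrict_space borel H)" and c: "c \<ge> 1"
  shows "integral_on n \<phi> H F \<le> ennreal (c ^ dim H) * integral_on n \<phi> H (\<lambda>x. F (c *\<^sub>R x))"
proof -
  have "integral_on n \<phi> H F
      = ennreal (c ^ dim H) * (\<integral>\<^sup>+x. F (c *\<^sub>R x) * ennreal (\<phi> (c *\<^sub>R x)) \<partial>lborel_subspace n H)"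
    unfolding integral_on_def
    by (rule nn_integral_lborel_subspace_scale) (use F phi_measurable_H c in auto)
  also have "\<dots> \<le> ennreal (c ^ dim H) * integral_on n \<phi> H (\<lambda>x. F (c *\<^sub>R x))"
    unfolding integral_on_def
  proof (rule mult_left_mono[OF nn_integral_mono])
    fix x assume "x \<in> space (lborel_subspace n H)"
    then have "x \<in> Rn n"
      using H_sub by auto
    then have "c *\<^sub>R x \<in> Rn n"
      by (intro subspace_scale subspace_Rn)
    moreover have "1 / c \<in> {0..1}"
      using c by auto
    ultimately have "\<phi> (c *\<^sub>R x) \<le> \<phi> ((1 / c) *\<^sub>R (c *\<^sub>R x))"
      using phi_radial unfolding radially_decreasing_def by blast
    then show "F (c *\<^sub>R x) * ennreal (\<phi> (c *\<^sub>R x)) \<le> F (c *\<^sub>R x) * ennreal (\<phi> x)"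
      using c by (intro mult_left_mono ennreal_leI) auto
  qed auto
  finally show ?thesis .
qed

text \<open>The difference set is a union of translates of \<open>U\<close>, hence open.\<close>

lemma difference_set_measurable:
  assumes U: "openin (Euclidean_space n) U"
  shows "(indicator (difference_set U) :: _ \<Rightarrow> ennreal) \<in> borel_measurable (restrict_space borel H)"
proof -
  have "openin (Euclidean_space n) (\<Union>b\<in>U. {x \<in> Rn n. b + 1 *\<^sub>R x \<in> U})"
    using U openin_subset[OF U] by (intro openin_Union) (auto intro: openin_affine_vimage simp del: scaleR_one)
  then have "(indicator (\<Union>b\<in>U. {x \<in> Rn n. b + 1 *\<^sub>R x \<in> U}) :: _ \<Rightarrow> ennreal) \<in> borel_measurable (restrict_space borel H)"
    using H_sub by (rule openin_indicator_measurable)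
  moreover have "indicator (difference_set U) x = (indicator (\<Union>b\<in>U. {x \<in> Rn n. b + 1 *\<^sub>R x \<in> U}) x :: ennreal)"
    if "x \<in> space (restrict_space borel H)" for x
    using that H_sub by (auto simp: space_restrict_space difference_set_def split: split_indicator)
  ultimately show ?thesis
    by (subst measurable_cong)
qed

text \<open>The integral over \<open>H\<close> of the volume \<open>g x\<close> of
  \<open>U \<inter> (U - x)\<close> is estimated in two ways: \<open>lower\<close> bounds
  \<open>g\<close> from below on the dilate of the difference set by \<open>l\<close>, and
  \<open>upper\<close> exchanges the integrals and applies \<open>S\<close> to each section. Finite
  volume permits cancelling the volume of \<open>U\<close> at the end.\<close>

lemma difference_set_finite_volume:
  assumes U: "openin (Euclidean_space n) U" "convex U" "U \<noteq> {}"
    and fin: "emeasure (lborel_Rn n) U < \<infinity>"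
    and S: "\<And>a. a \<in> U \<Longrightarrow> integral_on n \<phi> H (\<lambda>x. indicator U (a + x)) \<le> S"
    and l: "0 < l" "l < 1"
  shows "integral_on n \<phi> H (indicator (difference_set U))
    \<le> ennreal ((1 / l) ^ dim H * (1 / (1 - l)) ^ n) * S"
proof -
  let ?R = "lborel_Rn n" and ?L = "lborel_subspace n H" and ?D = "difference_set U"
  interpret R: sigma_finite_measure ?R
    by (rule sigma_finite_lborel_Rn)
  interpret L: sigma_finite_measure ?L
    by (rule sigma_finite_lborel_subspace)
  interpret RL: pair_sigma_finite ?R ?L ..
  define g :: "(nat \<Rightarrow> real) \<Rightarrow> ennreal" where
    "g x = (\<integral>\<^sup>+a. indicator U a * indicator U (a + x) \<partial>?R)" for x
  have URn: "U \<subseteq> Rn n"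
    using openin_subset[OF U(1)] .
  have Ub: "U \<in> sets ?R"
    by (rule openin_borel[OF U(1)])
  obtain W where W: "open W" "U = W \<inter> Rn n"
    using U by (auto simp: openin_Euclidean_space_iff)
  let ?A = "emeasure ?R U"
  have A: "?A > 0" "?A \<noteq> top"
    using emeasure_openin_pos[OF U(1)] U(3) fin by auto
  have add: "(\<lambda>p. fst p + snd p) \<in> ?R \<Otimes>\<^sub>M ?L \<rightarrow>\<^sub>M borel"
    unfolding fun_vec
    by (intro measurable_coordinatewise_then_product borel_measurable_add
        measurable_compose[OF measurable_fst coordinate_measurable_lborel_Rn]
        measurable_compose[OF measurable_snd coordinate_measurable_lborel_subspace])
  \<comment> \<open>Addition is measurable into \<open>borel\<close> on the whole function space, so
    the joint measurability needed for Fubini is obtained from the open set \<open>W\<close>, whose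
    trace on \<open>Rn n\<close> is \<open>U\<close>.\<close>
  have UW: "indicator U (a + x) = (indicator W (a + x) :: ennreal)" if "a \<in> Rn n" "x \<in> H" for a x
    using W(2) that H_sub subspace_add[OF subspace_Rn] by (auto split: split_indicator)
  have iU: "(\<lambda>p. indicator U (fst p)) \<in> borel_measurable (?R \<Otimes>\<^sub>M ?L)"
    by (rule measurable_compose[OF measurable_fst]) (use Ub in simp)
  have iW: "(\<lambda>p. indicator W (fst p + snd p) :: ennreal) \<in> borel_measurable (?R \<Otimes>\<^sub>M ?L)"
    by (rule measurable_compose[OF add]) (use W(1) in simp)
  have iphi: "(\<lambda>p. ennreal (\<phi> (snd p))) \<in> borel_measurable (?R \<Otimes>\<^sub>M ?L)"
    by (rule measurable_compose[OF measurable_snd]) (use phi_measurable_subspace in simp)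
  have joint: "(\<lambda>(a, x). indicator U a * indicator W (a + x) * ennreal (\<phi> x)) \<in> borel_measurable (?R \<Otimes>\<^sub>M ?L)"
    unfolding case_prod_beta using iU iW iphi by (intro borel_measurable_times_ennreal)
  have meas1: "(\<lambda>a. indicator U a * indicator U (a + x) :: ennreal) \<in> borel_measurable ?R" if "x \<in> H" for x
  proof -
    have "openin (Euclidean_space n) {a \<in> Rn n. x + 1 *\<^sub>R a \<in> U}"
      using that H_sub U(1) by (intro openin_affine_vimage) auto
    then have "indicator U a * indicator {a \<in> Rn n. x + 1 *\<^sub>R a \<in> U} a = (indicator U a * indicator U (a + x) :: ennreal)"
      if "a \<in> space ?R" for a
      using that by (auto simp: add.commute split: split_indicator)
    moreover have "(\<lambda>a. indicator U a * indicator {a \<in> Rn n. x + 1 *\<^sub>R a \<in> U} a :: ennreal) \<in> borel_measurable ?R"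
      using Ub openin_borel[OF \<open>openin (Euclidean_space n) {a \<in> Rn n. x + 1 *\<^sub>R a \<in> U}\<close>]
      by (intro borel_measurable_times_ennreal borel_measurable_indicator)
    ultimately show ?thesis
      by (simp only: cong: measurable_cong)
  qed
  \<comment> \<open>With \<open>b\<close> and \<open>b + x / l\<close> in \<open>U\<close>, the map
    sending \<open>u\<close> to \<open>l b + (1 - l) u\<close> takes \<open>U\<close> into
    \<open>U\<close>. Adding \<open>x\<close> stays in \<open>U\<close>, since the result is the
    combination of \<open>u\<close> and \<open>b + x / l\<close>. So
    \<open>U \<inter> (U - x)\<close> contains a copy of \<open>U\<close> scaled by
    \<open>1 - l\<close>.\<close>
  have lower: "ennreal ((1 - l) ^ n) * ?A * indicator ?D ((1 / l) *\<^sub>R x) \<le> g x" if x: "x \<in> H" for x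
  proof (cases "(1 / l) *\<^sub>R x \<in> ?D")
    case True
    then obtain b where b: "b \<in> U" "b + (1 / l) *\<^sub>R x \<in> U"
      by (auto simp: difference_set_def)
    have "?A = (\<integral>\<^sup>+u. indicator U u \<partial>?R)"
      using Ub by simp
    also have "\<dots> \<le> (\<integral>\<^sup>+u. indicator U (l *\<^sub>R b + (1 - l) *\<^sub>R u)
        * indicator U (l *\<^sub>R b + (1 - l) *\<^sub>R u + x) \<partial>?R)"
    proof (rule nn_integral_mono)
      fix u
      have "l *\<^sub>R b + (1 - l) *\<^sub>R u \<in> U" if "u \<in> U"
        using U(2) b(1) that l unfolding convex_iff_segment by (auto simp: add.commute)
      moreover have "l *\<^sub>R b + (1 - l) *\<^sub>R u + x \<in> U" if "u \<in> U"
      proof -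
        have "(1 - l) *\<^sub>R u + l *\<^sub>R (b + (1 / l) *\<^sub>R x) \<in> U"
          using U(2) b(2) that l unfolding convex_iff_segment by auto
        also have "(1 - l) *\<^sub>R u + l *\<^sub>R (b + (1 / l) *\<^sub>R x) = l *\<^sub>R b + (1 - l) *\<^sub>R u + x"
          using l by (simp add: scaleR_add_right algebra_simps)
        finally show ?thesis .
      qed
      ultimately show "(indicator U u :: ennreal) \<le> indicator U (l *\<^sub>R b + (1 - l) *\<^sub>R u)
        * indicator U (l *\<^sub>R b + (1 - l) *\<^sub>R u + x)"
        by (auto split: split_indicator)
    qed
    finally have "ennreal ((1 - l) ^ n) * ?A \<le> ennreal ((1 - l) ^ n) *
        (\<integral>\<^sup>+u. indicator U (l *\<^sub>R b + (1 - l) *\<^sub>R u) * indicator U (l *\<^sub>R b + (1 - l) *\<^sub>R u + x) \<partial>?R)"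
      by (rule mult_left_mono) simp
    also have "\<dots> = g x"
      unfolding g_def
      by (rule nn_integral_lborel_Rn_affine[symmetric])
         (use meas1[OF x] l b URn subspace_Rn in \<open>auto intro: subspace_scale\<close>)
    finally show ?thesis
      using True by simp
  qed simp
  have Dm: "(\<lambda>x. indicator ?D ((1 / l) *\<^sub>R x) :: ennreal) \<in> borel_measurable (restrict_space borel H)"
    by (rule measurable_scale_H[OF difference_set_measurable[OF U(1)]])
  have upper: "integral_on n \<phi> H g \<le> ?A * S"
  proof -
    have "integral_on n \<phi> H g = (\<integral>\<^sup>+x. (\<integral>\<^sup>+a. indicator U a * indicator W (a + x) * ennreal (\<phi> x) \<partial>?R) \<partial>?L)"
      unfolding integral_on_def
    proof (rule nn_integral_cong)
      fix x assume "x \<in> space ?L"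
      then have x: "x \<in> H" by simp
      have "g x * ennreal (\<phi> x) = (\<integral>\<^sup>+a. indicator U a * indicator U (a + x) * ennreal (\<phi> x) \<partial>?R)"
        unfolding g_def by (rule nn_integral_multc[OF meas1[OF x], symmetric])
      also have "\<dots> = (\<integral>\<^sup>+a. indicator U a * indicator W (a + x) * ennreal (\<phi> x) \<partial>?R)"
        by (rule nn_integral_cong) (use UW x in simp)
      finally show "g x * ennreal (\<phi> x) = \<dots>" .
    qed
    also have "\<dots> = (\<integral>\<^sup>+a. (\<integral>\<^sup>+x. indicator U a * indicator W (a + x) * ennreal (\<phi> x) \<partial>?L) \<partial>?R)"
      by (rule RL.Fubini'[OF joint])
    also have "\<dots> \<le> (\<integral>\<^sup>+a. S * indicator U a \<partial>?R)"
    proof (rule nn_integral_mono)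
      fix a assume "a \<in> space ?R"
      then have a: "a \<in> Rn n" by simp
      show "(\<integral>\<^sup>+x. indicator U a * indicator W (a + x) * ennreal (\<phi> x) \<partial>?L) \<le> S * indicator U a"
      proof (cases "a \<in> U")
        case True
        have "(\<integral>\<^sup>+x. indicator U a * indicator W (a + x) * ennreal (\<phi> x) \<partial>?L)
            = integral_on n \<phi> H (\<lambda>x. indicator U (a + x))"
          unfolding integral_on_def by (rule nn_integral_cong) (use True a UW in simp)
        then show ?thesis
          using S[OF True] True by simp
      qed simp
    qed
    also have "\<dots> = S * ?A"
      using Ub by (rule nn_integral_cmult_indicator)
    finally show ?thesis
      by (simp add: mult.commute)
  qed
  let ?I = "integral_on n \<phi> H (\<lambda>x. indicator ?D ((1 / l) *\<^sub>R x))"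
  have "ennreal ((1 - l) ^ n) * ?A * ?I
      = integral_on n \<phi> H (\<lambda>x. ennreal ((1 - l) ^ n) * ?A * indicator ?D ((1 / l) *\<^sub>R x))"
    by (rule integral_on_cmult[OF Dm, symmetric])
  also have "\<dots> \<le> ?A * S"
    by (rule order_trans[OF integral_on_mono upper]) (rule lower)
  finally have "?A * (ennreal ((1 - l) ^ n) * ?I) \<le> ?A * S"
    by (simp add: mult_ac)
  then have main: "ennreal ((1 - l) ^ n) * ?I \<le> S"
    using A by (simp add: ennreal_mult_le_mult_iff)
  have "integral_on n \<phi> H (indicator ?D) \<le> ennreal ((1 / l) ^ dim H) * ?I"
    by (rule integral_on_dilate) (use difference_set_measurable[OF U(1)] l in auto)
  \<comment> \<open>The factor \<open>(1 - l) ^ n\<close> is inserted with its inverse to make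
    \<open>main\<close> applicable.\<close>
  also have "?I = ennreal ((1 / (1 - l)) ^ n) * (ennreal ((1 - l) ^ n) * ?I)"
    using l by (simp add: mult.assoc[symmetric] ennreal_mult[symmetric] power_mult_distrib[symmetric])
  also have "ennreal ((1 / l) ^ dim H) * \<dots> \<le> ennreal ((1 / l) ^ dim H) * (ennreal ((1 / (1 - l)) ^ n) * S)"
    by (intro mult_left_mono main) auto
  also have "\<dots> = ennreal ((1 / l) ^ dim H * (1 / (1 - l)) ^ n) * S"
    using l by (simp add: mult.assoc ennreal_mult)
  finally show ?thesis .
qed

text \<open>A set \<open>V\<close> of possibly infinite volume is exhausted by its intersections
  with growing cubes, which are open, convex and of finite volume. Monotone convergence carries the
  bound over, as the constant does not depend on the piece.\<close>

lemma difference_set_bound: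
  assumes V: "openin (Euclidean_space n) V" "convex V" "V \<noteq> {}"
    and S: "\<And>a. a \<in> V \<Longrightarrow> integral_on n \<phi> H (\<lambda>x. indicator V (a + x)) \<le> S"
    and l: "0 < l" "l < 1"
  shows "integral_on n \<phi> H (indicator (difference_set V))
    \<le> ennreal ((1 / l) ^ dim H * (1 / (1 - l)) ^ n) * S"
proof -
  obtain z where z: "z \<in> V"
    using V(3) by auto
  have zR: "z \<in> Rn n"
    using V(1) z openin_subset by blast
  \<comment> \<open>This offset puts \<open>z\<close> into every cube, so no piece is empty.\<close>
  define r where "r = 1 + (\<Sum>i<n. \<bar>z i\<bar>)"
  define U where "U k = V \<inter> cube n (r + real k)" for k :: nat
  have mono: "U j \<subseteq> U k" if "j \<le> k" for j k
    using that by (force simp: U_def cube_def)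
  have zU: "z \<in> U k" for k
  proof -
    have "\<bar>z i\<bar> \<le> (\<Sum>i<n. \<bar>z i\<bar>)" if "i < n" for i
      using that by (intro member_le_sum[where f = "\<lambda>i. \<bar>z i\<bar>"]) auto
    then show ?thesis
      using z zR by (force simp: U_def cube_def r_def)
  qed
  have V_eq: "\<exists>k. v \<in> U k" if v: "v \<in> V" for v
  proof -
    obtain k :: nat where k: "(\<Sum>i<n. \<bar>v i\<bar>) < real k"
      using reals_Archimedean2 by blast
    have "\<bar>v i\<bar> \<le> (\<Sum>i<n. \<bar>v i\<bar>)" if "i < n" for i
      using that by (intro member_le_sum[where f = "\<lambda>i. \<bar>v i\<bar>"]) auto
    moreover have "r \<ge> 0"
      by (auto simp: r_def intro!: add_nonneg_nonneg sum_nonneg)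
    moreover have "v \<in> Rn n"
      using V(1) v openin_subset by blast
    ultimately have "v \<in> U k"
      using v k by (force simp: U_def cube_def)
    then show ?thesis ..
  qed
  have U: "openin (Euclidean_space n) (U k)" "convex (U k)" "U k \<noteq> {}" for k
    using V zU[of k] convex_cube[of n "r + real k"]
    by (auto simp: U_def convex_iff_segment intro: openin_Int openin_cube)
  have "emeasure (lborel_Rn n) (U k) < \<infinity>" for k
  proof -
    have "emeasure (lborel_Rn n) (U k) \<le> emeasure (lborel_Rn n) (cube n (r + real k))"
      by (rule emeasure_mono) (auto simp: U_def intro: openin_borel openin_cube)
    also have "\<dots> < \<infinity>"
      unfolding emeasure_cube
      by (cases "0 \<le> r + real k") (auto simp: less_top[symmetric] power_eq_top_ennreal)
    finally show ?thesis .
  qed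
  moreover have "integral_on n \<phi> H (\<lambda>x. indicator (U k) (a + x)) \<le> S" if "a \<in> U k" for a k
    by (rule order_trans[OF integral_on_mono S[of a]]) (use that in \<open>auto simp: U_def split: split_indicator\<close>)
  ultimately have bound: "integral_on n \<phi> H (indicator (difference_set (U k)))
      \<le> ennreal ((1 / l) ^ dim H * (1 / (1 - l)) ^ n) * S" for k
    using U[of k] l by (intro difference_set_finite_volume)
  let ?f = "\<lambda>k x. indicator (difference_set (U k)) x * ennreal (\<phi> x)"
  have inc: "incseq (\<lambda>k. indicator (difference_set (U k)) x :: ennreal)" for x
    using mono by (force simp: incseq_def difference_set_def split: split_indicator)
  have "(SUP k. indicator (difference_set (U k)) x :: ennreal) = indicator (difference_set V) x" for x
  proof (rule antisym)
    show "(SUP k. indicator (difference_set (U k)) x :: ennreal) \<le> indicator (difference_set V) x"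
      by (rule SUP_least) (auto simp: difference_set_def U_def split: split_indicator)
    show "indicator (difference_set V) x \<le> (SUP k. indicator (difference_set (U k)) x :: ennreal)"
    proof (cases "x \<in> difference_set V")
      case True
      then obtain b where b: "b \<in> V" "b + x \<in> V"
        by (auto simp: difference_set_def)
      then obtain i j where "b \<in> U i" "b + x \<in> U j"
        using V_eq by blast
      \<comment> \<open>Both witnesses have to lie in the same piece.\<close>
      then have "b \<in> U (max i j)" "b + x \<in> U (max i j)"
        using mono[of i "max i j"] mono[of j "max i j"] by auto
      then have "x \<in> difference_set (U (max i j))"
        by (auto simp: difference_set_def)
      then show ?thesis
        using True by (intro SUP_upper2[of "max i j"]) auto
    qed simp
  qed
  then have "integral_on n \<phi> H (indicator (difference_set V)) = (\<integral>\<^sup>+x. (SUP k. ?f k x) \<partial>lborel_subspace n H)"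
    unfolding integral_on_def by (simp add: SUP_mult_right_ennreal[symmetric])
  also have "\<dots> = (SUP k. \<integral>\<^sup>+x. ?f k x \<partial>lborel_subspace n H)"
  proof (rule nn_integral_monotone_convergence_SUP)
    show "incseq ?f"
      using inc by (auto simp: incseq_def le_fun_def intro!: mult_right_mono)
    show "?f k \<in> borel_measurable (lborel_subspace n H)" for k
      using difference_set_measurable[OF U(1)] phi_measurable_H sets_lborel_subspace
      by (simp cong: measurable_cong_sets)
  qed
  also have "\<dots> \<le> ennreal ((1 / l) ^ dim H * (1 / (1 - l)) ^ n) * S"
    using bound unfolding integral_on_def by (rule SUP_least)
  finally show ?thesis .
qed

end

section \<open>Support, difference function and the numerical constant\<close>

lemma interior_of_translate:
  assumes K: "K \<subseteq> Rn n" and z: "z \<in> Rn n"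
    and 0: "0 \<in> Euclidean_space n interior_of (translate K z)"
  shows "z \<in> Euclidean_space n interior_of K"
proof -
  let ?V = "Euclidean_space n interior_of (translate K z)"
  let ?W = "{x \<in> Rn n. - z + 1 *\<^sub>R x \<in> ?V}"
  have "openin (Euclidean_space n) ?W"
    using z by (intro openin_affine_vimage openin_interior_of subspace_neg subspace_Rn)
  moreover have "?W \<subseteq> K"
    using interior_of_subset[of "Euclidean_space n" "translate K z"]
    by (force simp: translate_def)
  moreover have "z \<in> ?W"
    using z 0 by simp
  ultimately show ?thesis
    using interior_of_maximal by blast
qed

lemma convex_supp:
  assumes f: "inv_concave n s f" "s \<ge> 0"
  shows "convex (supp n f)"
  unfolding convex_iff_segment
proof (intro ballI)
  fix x y and t :: real
  assume xy: "x \<in> supp n f" "y \<in> supp n f" and t: "t \<in> {0..1}"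
  then have x: "x \<in> Rn n" "f x > 0" and y: "y \<in> Rn n" "f y > 0"
    by (auto simp: supp_def)
  have "(1 - t) *\<^sub>R x + t *\<^sub>R y \<in> Rn n"
    using x y by (intro subspace_add subspace_scale subspace_Rn)
  moreover have "0 < (if s = 0 then max (f x) (f y)
      else ((1 - t) * f x powr (1 / s) + t * f y powr (1 / s)) powr s)"
  proof -
    \<comment> \<open>This also holds for \<open>s = 0\<close>, where \<open>1 / s\<close> is 0 and
      both powers equal 1. The first summand is positive unless \<open>t = 1\<close>.\<close>
    have "0 < (1 - t) * f x powr (1 / s) + t * f y powr (1 / s)"
    proof (cases "t = 1")
      case False
      then have "0 < (1 - t) * f x powr (1 / s)"
        using t x by auto
      then show ?thesis
        using t by (simp add: add_pos_nonneg)
    qed (use y in simp)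
    then show ?thesis
      using x by (auto simp: less_max_iff_disj)
  qed
  moreover have "f x * f y > 0"
    using x y by simp
  ultimately show "(1 - t) *\<^sub>R x + t *\<^sub>R y \<in> supp n f"
    using f(1) x(1) y(1) t unfolding inv_concave_def supp_def by fastforce
qed

text \<open>Concavity is applied at the midpoint of 0 and \<open>x\<close>. Dropping the nonnegative
  contribution of \<open>x\<close> leaves \<open>(f 0 powr (1 / s) / 2) powr s\<close>, which is
  \<open>2 powr - s * f 0\<close>; for \<open>s = 0\<close> the maximum already gives the
  claim.\<close>

lemma inv_concave_half:
  assumes f: "inv_concave n s f" "s \<ge> 0" and x: "x \<in> Rn n" "f x > 0" and max: "f x \<le> f 0"
  shows "f 0 * 2 powr - s \<le> f ((1 / 2) *\<^sub>R x)"
proof -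
  have 0: "0 \<in> Rn n"
    by (rule subspace_0[OF subspace_Rn])
  have "(if s = 0 then max (f 0) (f x)
      else ((1 - 1/2) * f 0 powr (1 / s) + (1/2) * f x powr (1 / s)) powr s) \<le> f ((1 - 1/2) *\<^sub>R 0 + (1/2) *\<^sub>R x)"
    by (rule f(1)[unfolded inv_concave_def, rule_format]) (use 0 x max in auto)
  moreover have "f 0 * 2 powr - s \<le> (if s = 0 then max (f 0) (f x)
      else ((1 - 1/2) * f 0 powr (1 / s) + (1/2) * f x powr (1 / s)) powr s)"
  proof (cases "s = 0")
    case False
    have "f 0 * 2 powr - s = (f 0 powr (1 / s) / 2) powr s"
      using False x max f(2) by (simp add: powr_divide powr_powr powr_minus_divide)
    also have "\<dots> \<le> ((1 - 1/2) * f 0 powr (1 / s) + (1/2) * f x powr (1 / s)) powr s"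
      using f(2) by (intro powr_mono2) auto
    finally show ?thesis
      using False by simp
  qed simp
  ultimately show ?thesis
    by simp
qed

lemma M_inv_le:
  assumes s: "s \<ge> 0" and ab: "0 \<le> a" "0 \<le> b" "a \<le> c" "b \<le> c"
  shows "M_inv s a b \<le> 2 powr s * c"
proof (cases "a * b > 0 \<and> s \<noteq> 0")
  case True
  then have pos: "s > 0" "c > 0"
    using s ab by (auto simp: zero_less_mult_iff)
  have "M_inv s a b = (a powr (1 / s) + b powr (1 / s)) powr s"
    using True by (simp add: M_inv_def)
  also have "\<dots> \<le> (2 * c powr (1 / s)) powr s"
    using pos ab powr_mono2[of "1 / s" a c] powr_mono2[of "1 / s" b c] by (intro powr_mono2) auto
  also have "\<dots> = 2 powr s * c"
    using pos by (simp add: powr_mult powr_powr)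
  finally show ?thesis .
qed (use ab in \<open>auto simp: M_inv_def\<close>)

text \<open>A nonzero term has both \<open>x1\<close> and \<open>x2\<close> in the support. Moving
  each halfway towards the interior point \<open>z\<close> lands in the interior, and the difference
  of the two midpoints is half of \<open>x\<close>. The value itself is controlled by
  \<open>M_inv_le\<close>.\<close>

lemma difference_fun_le:
  assumes f: "\<And>x. x \<in> Rn n \<Longrightarrow> 0 \<le> f x" "\<And>x. x \<in> Rn n \<Longrightarrow> f x \<le> f 0"
      "inv_concave n s f" "s \<ge> 0"
    and z: "z \<in> Euclidean_space n interior_of supp n f"
  shows "difference_fun n s f x
    \<le> ennreal (2 powr s * f 0) * indicator (difference_set (Euclidean_space n interior_of supp n f)) ((1 / 2) *\<^sub>R x)"
  unfolding difference_fun_def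
proof (rule SUP_least, clarify)
  fix x1 x2
  assume x: "x1 \<in> Rn n" "x2 \<in> Rn n" "x = x1 - x2"
  let ?V = "Euclidean_space n interior_of supp n f"
  show "ennreal (M_inv s (f x1) (f x2)) \<le> ennreal (2 powr s * f 0) * indicator (difference_set ?V) ((1 / 2) *\<^sub>R (x1 - x2))"
  proof (cases "f x1 * f x2 > 0")
    case True
    then have supp: "x1 \<in> supp n f" "x2 \<in> supp n f"
      using x f(1)[of x1] f(1)[of x2] by (auto simp: supp_def zero_less_mult_iff)
    have half: "(1 / 2) *\<^sub>R z + (1 / 2) *\<^sub>R y \<in> ?V" if "y \<in> supp n f" for y
      using convex_interior_combine[OF convex_supp[OF f(3,4)] _ z that, of "1/2"] by (auto simp: supp_def)
    have "(1 / 2) *\<^sub>R z + (1 / 2) *\<^sub>R x2 + (1 / 2) *\<^sub>R (x1 - x2) = (1 / 2) *\<^sub>R z + (1 / 2) *\<^sub>R x1"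
      by (simp add: scaleR_diff_right)
    then have "(1 / 2) *\<^sub>R (x1 - x2) \<in> difference_set ?V"
      unfolding difference_set_def mem_Collect_eq
      by (intro bexI[OF _ half[OF supp(2)]]) (simp only: half[OF supp(1)])
    then show ?thesis
      using x f M_inv_le[of s "f x1" "f x2" "f 0"] by (simp add: ennreal_leI)
  qed (simp add: M_inv_def)
qed

text \<open>For this \<open>l\<close>, the factor \<open>1 / l\<close> is at most
  \<open>2 n / m\<close>, and \<open>1 / (1 - l)\<close> is \<open>1 + m / n\<close>, whose
  \<open>n\<close>-th power is at most \<open>exp 1 ^ m\<close>, hence at most \<open>3 ^ m\<close>.
  The constant is \<open>24 = 4 * 2 * 3\<close>.\<close>

lemma constant_estimate:
  fixes m n :: nat and s :: real
  assumes m: "1 \<le> m" "m \<le> n" and s: "0 \<le> s"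
  defines "l \<equiv> real m / (real n + real m)"
  shows "4 powr (real m + s) * ((1 / l) ^ m * (1 / (1 - l)) ^ n)
    \<le> (24 * ((real n + 1) * (real n + s) / (real m * (real m + 1)))) powr (real m + s)"
proof -
  define q where "q = (real n + 1) * (real n + s) / (real m * (real m + 1))"
  have mn: "real m \<ge> 1" "real m \<le> real n"
    using m by auto
  have q: "real n / real m \<le> q"
  proof -
    have "real n / real m = (real m + 1) * real n / (real m * (real m + 1))"
      using mn mult_divide_mult_cancel_left[of "real m + 1" "real n" "real m"] by (simp add: mult.commute)
    also have "\<dots> \<le> q"
      unfolding q_def using mn s by (intro divide_right_mono mult_mono) auto
    finally show ?thesis .
  qed
  have q1: "1 \<le> real n / real m"
    using mn by simp
  have "1 / l = (real n + real m) / real m"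
    by (simp add: l_def)
  also have "\<dots> \<le> 2 * (real n / real m)"
    using mn by (simp add: field_simps)
  finally have "(1 / l) ^ m \<le> (2 * (real n / real m)) ^ m"
    using mn by (intro power_mono) (auto simp: l_def)
  moreover have "(1 / (1 - l)) ^ n \<le> 3 ^ m"
  proof -
    have "1 / (1 - l) = 1 + real m / real n"
      using mn by (simp add: l_def field_simps)
    also have "(\<dots>) ^ n \<le> exp (real m / real n) ^ n"
      by (intro power_mono exp_ge_add_one_self) (use mn in auto)
    also have "\<dots> = exp 1 ^ m"
      using mn by (simp flip: exp_of_nat_mult)
    also have "\<dots> \<le> 3 ^ m"
      by (intro power_mono exp_le) auto
    finally show ?thesis .
  qed
  ultimately have "(1 / l) ^ m * (1 / (1 - l)) ^ n \<le> (2 * (real n / real m)) ^ m * 3 ^ m"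
    using mn by (intro mult_mono) (auto simp: l_def)
  also have "\<dots> = (6 * (real n / real m)) ^ m"
    by (simp flip: power_mult_distrib)
  also have "\<dots> \<le> (6 * q) ^ m"
    using q q1 by (intro power_mono) auto
  also have "\<dots> = (6 * q) powr real m"
    using q q1 by (simp add: powr_realpow)
  \<comment> \<open>Raising the exponent from \<open>m\<close> to \<open>m + s\<close> is harmless
    because \<open>1 \<le> n / m \<le> q\<close>.\<close>
  also have "\<dots> \<le> (6 * q) powr (real m + s)"
    using q q1 s by (intro powr_mono) auto
  finally have "4 powr (real m + s) * ((1 / l) ^ m * (1 / (1 - l)) ^ n)
      \<le> 4 powr (real m + s) * (6 * q) powr (real m + s)"
    by (intro mult_left_mono) auto
  also have "\<dots> = (24 * q) powr (real m + s)"
    using q q1 by (simp flip: powr_mult)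
  finally show ?thesis
    unfolding q_def .
qed

section \<open>Sections of the support and the final inequality\<close>

context radial_density
begin

text \<open>After dilation by 2, a point \<open>x\<close> of the section satisfies
  \<open>a + 2 x\<close> in the support, and \<open>inv_concave_half\<close> at this point bounds
  \<open>f (x + a / 2)\<close> from below. So the translate by \<open>a / 2\<close> is a competitor
  in the supremum.\<close>

lemma interior_supp_section_le:
  assumes f: "\<And>x. x \<in> Rn n \<Longrightarrow> f x \<le> f 0" "inv_concave n s f" "s \<ge> 0" "f 0 > 0"
    and a: "a \<in> Rn n"
  shows "integral_on n \<phi> H (\<lambda>x. indicator (Euclidean_space n interior_of supp n f) (a + x))
    \<le> ennreal (2 powr (real (dim H) + s) / f 0)
      * (SUP y\<in>Rn n. integral_on n \<phi> H (\<lambda>x. ennreal (f (x + y))))"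
proof -
  let ?V = "Euclidean_space n interior_of supp n f"
  let ?T = "SUP y\<in>Rn n. integral_on n \<phi> H (\<lambda>x. ennreal (f (x + y)))"
  let ?A = "{x \<in> Rn n. a + 1 *\<^sub>R x \<in> ?V}"
  have A: "openin (Euclidean_space n) ?A"
    using a by (intro openin_affine_vimage openin_interior_of)
  have eq: "indicator ?V (a + x) = (indicator ?A x :: ennreal)" if "x \<in> H" for x
    using that H_sub by (auto split: split_indicator)
  have Am: "(indicator ?A :: _ \<Rightarrow> ennreal) \<in> borel_measurable (restrict_space borel H)"
    by (rule openin_indicator_measurable[OF A H_sub])
  have le: "ennreal (f 0 * 2 powr - s) * indicator ?A (2 *\<^sub>R x) \<le> ennreal (f (x + (1 / 2) *\<^sub>R a))"
    if x: "x \<in> H" for x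
  proof (cases "2 *\<^sub>R x \<in> ?A")
    case True
    then have "a + 2 *\<^sub>R x \<in> supp n f"
      using interior_of_subset[of "Euclidean_space n" "supp n f"] by auto
    then have y: "a + 2 *\<^sub>R x \<in> Rn n" "f (a + 2 *\<^sub>R x) > 0"
      by (auto simp: supp_def)
    have "f 0 * 2 powr - s \<le> f ((1 / 2) *\<^sub>R (a + 2 *\<^sub>R x))"
      by (rule inv_concave_half[OF f(2,3) y f(1)[OF y(1)]])
    also have "(1 / 2) *\<^sub>R (a + 2 *\<^sub>R x) = x + (1 / 2) *\<^sub>R a"
      by (simp add: scaleR_add_right)
    finally have "ennreal (f 0 * 2 powr - s) \<le> ennreal (f (x + (1 / 2) *\<^sub>R a))"
      by (rule ennreal_leI)
    then show ?thesis
      by (simp only: indicator_simps(1)[OF True] mult_1_right)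
  qed simp
  have "integral_on n \<phi> H (\<lambda>x. indicator ?V (a + x)) \<le> integral_on n \<phi> H (indicator ?A)"
    by (rule integral_on_mono) (simp add: eq)
  also have "\<dots> \<le> ennreal (2 ^ dim H) * integral_on n \<phi> H (\<lambda>x. indicator ?A (2 *\<^sub>R x))"
    by (rule integral_on_dilate[OF Am]) simp
  \<comment> \<open>The lower bound for \<open>f\<close> is inserted together with its inverse. It
    is moved under the integral of the indicator, which is measurable; \<open>f\<close> then enters
    through monotonicity alone.\<close>
  also have "integral_on n \<phi> H (\<lambda>x. indicator ?A (2 *\<^sub>R x))
      = ennreal (2 powr s / f 0) * (ennreal (f 0 * 2 powr - s) * integral_on n \<phi> H (\<lambda>x. indicator ?A (2 *\<^sub>R x)))"
    using f(4) by (simp add: mult.assoc[symmetric] ennreal_mult[symmetric] powr_minus)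
  also have "ennreal (f 0 * 2 powr - s) * integral_on n \<phi> H (\<lambda>x. indicator ?A (2 *\<^sub>R x))
      = integral_on n \<phi> H (\<lambda>x. ennreal (f 0 * 2 powr - s) * indicator ?A (2 *\<^sub>R x))"
    by (rule integral_on_cmult[OF measurable_scale_H[OF Am], symmetric])
  also have "ennreal (2 ^ dim H) * (ennreal (2 powr s / f 0) * \<dots>)
      \<le> ennreal (2 ^ dim H) * (ennreal (2 powr s / f 0) * ?T)"
  proof (intro mult_left_mono)
    have "integral_on n \<phi> H (\<lambda>x. ennreal (f 0 * 2 powr - s) * indicator ?A (2 *\<^sub>R x))
        \<le> integral_on n \<phi> H (\<lambda>x. ennreal (f (x + (1 / 2) *\<^sub>R a)))"
      by (rule integral_on_mono[OF le])
    also have "\<dots> \<le> ?T"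
      using a by (intro SUP_upper subspace_scale subspace_Rn)
    finally show "integral_on n \<phi> H (\<lambda>x. ennreal (f 0 * 2 powr - s) * indicator ?A (2 *\<^sub>R x)) \<le> ?T" .
  qed auto
  also have "\<dots> = ennreal (2 powr (real (dim H) + s) / f 0) * ?T"
    using f(4) by (simp add: mult.assoc[symmetric] ennreal_mult[symmetric] powr_add powr_realpow)
  finally show ?thesis .
qed

text \<open>The powers of 2 come from three sources: \<open>2 powr s\<close> from the pointwise
  bound on the difference function, \<open>2 ^ dim H\<close> from halving the argument of the
  indicator, and \<open>2 powr (dim H + s)\<close> from the sections. Together they give
  \<open>4 powr (dim H + s)\<close>, while \<open>f 0\<close> cancels.\<close>

lemma integral_difference_fun_le:
  assumes f: "\<And>x. x \<in> Rn n \<Longrightarrow> 0 \<le> f x" "\<And>x. x \<in> Rn n \<Longrightarrow> f x \<le> f 0"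
      "inv_concave n s f" "s \<ge> 0"
    and z: "z \<in> Euclidean_space n interior_of supp n f"
    and m: "1 \<le> dim H" "dim H \<le> n"
  shows "integral_on n \<phi> H (difference_fun n s f)
    \<le> ennreal ((24 * ((real n + 1) * (real n + s) / (real (dim H) * (real (dim H) + 1)))) powr (real (dim H) + s))
      * (SUP y\<in>Rn n. integral_on n \<phi> H (\<lambda>x. ennreal (f (x + y))))"
proof -
  let ?m = "dim H"
  let ?V = "Euclidean_space n interior_of supp n f"
  let ?D = "difference_set ?V"
  define T where "T = (SUP y\<in>Rn n. integral_on n \<phi> H (\<lambda>x. ennreal (f (x + y))))"
  \<comment> \<open>This choice maximizes \<open>l ^ m * (1 - l) ^ n\<close>, so it gives the
    smallest factor in \<open>difference_set_bound\<close>.\<close>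
  define l where "l = real ?m / (real n + real ?m)"
  define c where "c = (1 / l) ^ ?m * (1 / (1 - l)) ^ n"
  have l: "0 < l" "l < 1"
    using m by (auto simp: l_def)
  have c: "c \<ge> 0"
    using l by (simp add: c_def)
  have "z \<in> supp n f"
    using z interior_of_subset[of "Euclidean_space n" "supp n f"] by auto
  then have f0: "f 0 > 0"
    using f(2) by (force simp: supp_def)
  have V: "openin (Euclidean_space n) ?V" "convex ?V" "?V \<noteq> {}"
    using z convex_interior[OF convex_supp[OF f(3,4)]] by (auto simp: supp_def)
  let ?J = "integral_on n \<phi> H (\<lambda>x. indicator ?D ((1 / 2) *\<^sub>R x))"
  have "?J \<le> ennreal (2 ^ ?m) * integral_on n \<phi> H (\<lambda>x. indicator ?D ((1 / 2) *\<^sub>R (2 *\<^sub>R x)))"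
    by (rule integral_on_dilate[OF measurable_scale_H[OF difference_set_measurable[OF V(1)]]]) simp
  also have "\<dots> = ennreal (2 ^ ?m) * integral_on n \<phi> H (indicator ?D)"
    by simp
  also have "\<dots> \<le> ennreal (2 ^ ?m) * (ennreal c * (ennreal (2 powr (real ?m + s) / f 0) * T))"
    unfolding c_def T_def
    using openin_subset[OF V(1)]
    by (intro mult_left_mono[OF difference_set_bound[OF V _ l]] interior_supp_section_le f f0) auto
  finally have J: "?J \<le> ennreal (2 ^ ?m) * (ennreal c * (ennreal (2 powr (real ?m + s) / f 0) * T))" .
  have "integral_on n \<phi> H (difference_fun n s f)
      \<le> integral_on n \<phi> H (\<lambda>x. ennreal (2 powr s * f 0) * indicator ?D ((1 / 2) *\<^sub>R x))"
    by (intro integral_on_mono difference_fun_le[OF f z])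
  also have "\<dots> = ennreal (2 powr s * f 0) * ?J"
    by (intro integral_on_cmult measurable_scale_H difference_set_measurable V)
  also have "\<dots> \<le> ennreal (2 powr s * f 0) *
      (ennreal (2 ^ ?m) * (ennreal c * (ennreal (2 powr (real ?m + s) / f 0) * T)))"
    by (rule mult_left_mono[OF J]) simp
  also have "ennreal (2 powr s * f 0) * (ennreal (2 ^ ?m) * (ennreal c * (ennreal (2 powr (real ?m + s) / f 0) * T)))
      = ennreal (4 powr (real ?m + s) * c) * T"
  proof -
    have "(2 powr s * f 0) * 2 ^ ?m * c * (2 powr (real ?m + s) / f 0) = 2 powr (real ?m + s) * 2 powr (real ?m + s) * c"
      using f0 by (simp add: powr_add powr_realpow)
    also have "\<dots> = 4 powr (real ?m + s) * c"
      by (simp flip: powr_mult)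
    finally have *: "(2 powr s * f 0) * 2 ^ ?m * c * (2 powr (real ?m + s) / f 0) = 4 powr (real ?m + s) * c" .
    have "ennreal a * (ennreal b * (ennreal c * (ennreal d * T))) = ennreal (a * b * c * d) * T"
      if "0 \<le> a" "0 \<le> b" "0 \<le> d" for a b d
      using that c by (simp add: ennreal_mult mult.assoc)
    from this[of "2 powr s * f 0" "2 ^ ?m" "2 powr (real ?m + s) / f 0"] show ?thesis
      using f0 unfolding * by simp
  qed
  also have "\<dots> \<le> ennreal ((24 * ((real n + 1) * (real n + s) / (real ?m * (real ?m + 1)))) powr (real ?m + s)) * T"
    unfolding c_def l_def using constant_estimate[OF m f(4)] by (intro mult_right_mono ennreal_leI) auto
  finally show ?thesis
    unfolding T_def .
qed

end

theorem theorem17: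
  shows "\<exists>C>1. \<forall>(m::nat) (n::nat) (\<phi> :: (nat \<Rightarrow> real) \<Rightarrow> real) (s::real)
      (H :: (nat \<Rightarrow> real) set) (f :: (nat \<Rightarrow> real) \<Rightarrow> real) (z0 :: nat \<Rightarrow> real).
    1 \<le> m \<longrightarrow> m \<le> n \<longrightarrow>
    \<phi> \<in> borel_measurable (lborel_Rn n) \<longrightarrow> (\<forall>x\<in>Rn n. 0 \<le> \<phi> x) \<longrightarrow> radially_decreasing n \<phi> \<longrightarrow>
    0 \<le> s \<longrightarrow>
    H \<subseteq> Rn n \<longrightarrow> subspace H \<longrightarrow> dim H = m \<longrightarrow>
    (\<forall>x\<in>Rn n. 0 \<le> f x) \<longrightarrow> integrable (completion (density_Rn n \<phi>)) f \<longrightarrow>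
    inv_concave n s f \<longrightarrow> (\<forall>x\<in>Rn n. f x \<le> f 0) \<longrightarrow>
    z0 \<in> Rn n \<longrightarrow>
    (SUP z\<in>Rn n. measure_on n \<phi> H (translate (supp n f) z))
      = measure_on n \<phi> H (translate (supp n f) z0) \<longrightarrow>
    0 \<in> Euclidean_space n interior_of (translate (supp n f) z0) \<longrightarrow>
    integral_on n \<phi> H (difference_fun n s f)
      \<le> ennreal ((C * ((real n + 1) * (real n + s) / (real m * (real m + 1)))) powr (real m + s))
        * (SUP y\<in>Rn n. integral_on n \<phi> H (\<lambda>x. ennreal (f (x + y))))"
proof (intro exI[of _ 24] conjI allI impI)
  fix m n :: nat and \<phi> :: "(nat \<Rightarrow> real) \<Rightarrow> real" and s :: real and H :: "(nat \<Rightarrow> real) set"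
    and f :: "(nat \<Rightarrow> real) \<Rightarrow> real" and z0 :: "nat \<Rightarrow> real"
  assume m: "1 \<le> m" "m \<le> n" and phi: "\<phi> \<in> borel_measurable (lborel_Rn n)" "radially_decreasing n \<phi>"
    and s: "0 \<le> s" and H: "H \<subseteq> Rn n" "subspace H" "dim H = m"
    and f: "\<forall>x\<in>Rn n. 0 \<le> f x" "inv_concave n s f" "\<forall>x\<in>Rn n. f x \<le> f 0"
    and z0: "z0 \<in> Rn n" "0 \<in> Euclidean_space n interior_of (translate (supp n f) z0)"
  interpret radial_density n H \<phi>
    by standard (use H phi in auto)
  have "z0 \<in> Euclidean_space n interior_of supp n f"
    by (rule interior_of_translate[OF _ z0]) (auto simp: supp_def)
  then show "integral_on n \<phi> H (difference_fun n s f)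
      \<le> ennreal ((24 * ((real n + 1) * (real n + s) / (real m * (real m + 1)))) powr (real m + s))
        * (SUP y\<in>Rn n. integral_on n \<phi> H (\<lambda>x. ennreal (f (x + y))))"
    using integral_difference_fun_le[of f s z0] f s m unfolding H(3) by blast
qed simp

end
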